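(* There exists a deterministic online algorithm, running in polynomial time, for the single-item Online Joint Replenishment Problem with holding and backlog costs (with arbitrary, request-dependent monotone holding and backlog cost functions, as defined in the context) which is $4$-competitive: for every finite request sequence $\sigma$, $ALG(\sigma)\le 4\cdot OPT(\sigma)$.
   Context: Single-item Online JRP with holding and backlog costs. There is a fixed service (ordering) cost $c>0$. Requests arrive online; a request $p$ is a triple $(a_p,d_p,c_p)$, where $a_p$ is its arrival time (the online algorithm learns of $p$ only at time $a_p$), $d_p\ge a_p$ is its deadline, and $c_p:[a_p,\infty)\to\mathbb{R}_{\ge 0}$ is its cost function, which is monotone non-increasing on $[a_p,d_p]$ (holding cost) and monotone non-decreasing on $[d_p,\infty)$ (backlog cost); different requests may have different cost functions. An algorithm triggers services at times of its choice; a service at time $t$ costs $c$ and may satisfy any set of requests that have arrived by time $t$ and are not yet satisfied. Every request must be satisfied exactly once; if request $p$ is satisfied at time $t_p\ge a_p$, the algorithm pays $c_p(t_p)$ for it. The total cost of an algorithm on a request sequence $\sigma$ is $c$ times its number of services plus $\sum_p c_p(t_p)$. $ALG(\sigma)$ denotes the cost of the online algorithm and $OPT(\sigma)$ the cost of an optimal offline solution (which knows $\sigma$ in advance). An online algorithm is $\alpha$-competitive if $ALG(\sigma)\le\alpha\cdot OPT(\sigma)$ for every request sequence $\sigma$.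
   Formalization: Each cost function is also assumed to tend to infinity and to be left-continuous after its deadline (else no constant ratio is possible); polynomial time is unit-cost real-RAM steps with oracles for c_p(t) and the last time the backlog cost is at most v. *)

theory Defs
  imports "HOL-Analysis.Analysis" "HOL-Computational_Algebra.Polynomial"
begin

section \<open>Requests, schedules, offline optimum\<close>

record request =
  arrival :: real
  deadline :: real
  cost_fun :: "real \<Rightarrow> real"

text \<open>
  The last two conditions make explicit what the online problem needs in continuous time with an
  unbounded horizon; without either of them no online algorithm is competitive.

  \<^item> Unbounded backlog costs. If all cost functions are identically 0, an online algorithm has to
    serve every request at some finite time, and the adversary releases the next request after that
    service; it is charged one service per request, while a single late service is optimal.

  \<^item> Left-continuity after the deadline (upward jumps immediately after a point are allowed, also
    at the deadline itself). If a request costs 0 before time 1 and a huge amount from time 1 on,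
    it has to be served at some time before 1, and the adversary then releases another such
    request between that service and time 1, and so on; a single service just before time 1 is
    offline optimal up to an arbitrarily small amount.

  The holding part need not be continuous, and only times from the arrival on are constrained.
\<close>

definition valid_request :: "request \<Rightarrow> bool" where
  "valid_request p \<longleftrightarrow>
     arrival p \<le> deadline p \<and>
     (\<forall>t \<ge> arrival p. 0 \<le> cost_fun p t) \<and>
     antimono_on {arrival p..deadline p} (cost_fun p) \<and>
     mono_on {deadline p..} (cost_fun p) \<and>
     filterlim (cost_fun p) at_top at_top \<and>
     (\<forall>t > deadline p. continuous (at_left t) (cost_fun p))"

text \<open>Requests are identified by their position, so equal requests may occur repeatedly.\<close>

definition request_sequence :: "request list \<Rightarrow> bool" where
  "request_sequence \<sigma> \<longleftrightarrow> (\<forall>p \<in> set \<sigma>. valid_request p) \<and> sorted (map arrival \<sigma>)"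

text \<open>A schedule lists its services: the time, and the positions of the requests satisfied.\<close>

type_synonym schedule = "(real \<times> nat set) list"

definition feasible :: "request list \<Rightarrow> schedule \<Rightarrow> bool" where
  "feasible \<sigma> S \<longleftrightarrow>
     (\<forall>(t, J) \<in> set S. \<forall>i \<in> J. i < length \<sigma> \<and> arrival (\<sigma> ! i) \<le> t) \<and>
     (\<forall>i < length \<sigma>. \<exists>!k. k < length S \<and> i \<in> snd (S ! k))"

definition schedule_cost :: "real \<Rightarrow> request list \<Rightarrow> schedule \<Rightarrow> real" where
  "schedule_cost c \<sigma> S =
     c * real (length S) + (\<Sum>(t, J)\<leftarrow>S. \<Sum>i\<in>J. cost_fun (\<sigma> ! i) t)"

text \<open>An infimum, since discontinuous cost functions need not admit a cheapest schedule.\<close>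

definition OPT :: "real \<Rightarrow> request list \<Rightarrow> real" where
  "OPT c \<sigma> = (INF S \<in> {S. feasible \<sigma> S}. schedule_cost c \<sigma> S)"


section \<open>Online algorithms as real-RAM programs with cost oracles\<close>

text \<open>
  Deterministic online algorithms are structured programs for a unit-cost RAM with a natural-number
  memory (addition and truncated subtraction only) and a real memory (field operations and
  comparison, no rounding). The same program has to work for every service cost and every request
  sequence. It is run at certain instants (see \<open>execution\<close> below), where it sees the service cost,
  the current time and the requests released so far. Cost functions, being arbitrary real
  functions, are accessible through two oracles only: the value at a point, and the last time up to
  which the backlog part stays below a given level.
\<close>

definition last_time :: "request \<Rightarrow> real \<Rightarrow> real" where
  "last_time p v =
     (if cost_fun p (deadline p) \<le> v then Sup {t. deadline p \<le> t \<and> cost_fun p t \<le> v}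
      else deadline p)"

record env =
  service_cost :: real
  now :: real
  released :: "request list"

record state =
  nat_mem :: "nat \<Rightarrow> nat"
  real_mem :: "nat \<Rightarrow> real"
  served_now :: "nat set"
  wakeup :: "real option"

datatype nexp =
    NConst nat
  | NMem nexp
  | NumReleased
  | NPlus nexp nexp
  | NMinus nexp nexp

datatype rexp =
    RNat nexp
  | RMem nexp
  | RPlus rexp rexp
  | RMinus rexp rexp
  | RTimes rexp rexp
  | RDivide rexp rexp
  | ServiceCost
  | Now
  | Arrival nexp
  | Deadline nexp
  | CostAt nexp rexp
  | LastTime nexp rexp

datatype bexp =
    NLess nexp nexp
  | RLess rexp rexp
  | Neg bexp
  | Conj bexp bexp

datatype com =
    Skip
  | NAssign nexp nexp
  | RAssign nexp rexp
  | Serve nexp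
  | Wakeup rexp
  | Seq com com
  | Cond bexp com com
  | While bexp com

fun nval :: "env \<Rightarrow> state \<Rightarrow> nexp \<Rightarrow> nat" where
  "nval E s (NConst k) = k"
| "nval E s (NMem a) = nat_mem s (nval E s a)"
| "nval E s NumReleased = length (released E)"
| "nval E s (NPlus a b) = nval E s a + nval E s b"
| "nval E s (NMinus a b) = nval E s a - nval E s b"

text \<open>Queries about requests not yet released, or costs before the arrival, yield 0.\<close>

definition query :: "env \<Rightarrow> nat \<Rightarrow> (request \<Rightarrow> real) \<Rightarrow> real" where
  "query E i f = (if i < length (released E) then f (released E ! i) else 0)"

fun rval :: "env \<Rightarrow> state \<Rightarrow> rexp \<Rightarrow> real" where
  "rval E s (RNat a) = real (nval E s a)"
| "rval E s (RMem a) = real_mem s (nval E s a)"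
| "rval E s (RPlus x y) = rval E s x + rval E s y"
| "rval E s (RMinus x y) = rval E s x - rval E s y"
| "rval E s (RTimes x y) = rval E s x * rval E s y"
| "rval E s (RDivide x y) = rval E s x / rval E s y"
| "rval E s ServiceCost = service_cost E"
| "rval E s Now = now E"
| "rval E s (Arrival a) = query E (nval E s a) arrival"
| "rval E s (Deadline a) = query E (nval E s a) deadline"
| "rval E s (CostAt a x) =
     query E (nval E s a)
       (\<lambda>p. if arrival p \<le> rval E s x then cost_fun p (rval E s x) else 0)"
| "rval E s (LastTime a x) = query E (nval E s a) (\<lambda>p. last_time p (rval E s x))"

fun bval :: "env \<Rightarrow> state \<Rightarrow> bexp \<Rightarrow> bool" where
  "bval E s (NLess a b) \<longleftrightarrow> nval E s a < nval E s b"
| "bval E s (RLess x y) \<longleftrightarrow> rval E s x < rval E s y"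
| "bval E s (Neg b) \<longleftrightarrow> \<not> bval E s b"
| "bval E s (Conj b1 b2) \<longleftrightarrow> bval E s b1 \<and> bval E s b2"

text \<open>
  The number counts executed commands and tests. The expressions in a program have bounded size,
  so this is the number of unit-cost RAM operations up to a constant factor.
\<close>

inductive big_step :: "env \<Rightarrow> com \<Rightarrow> state \<Rightarrow> nat \<Rightarrow> state \<Rightarrow> bool" for E where
  Skip: "big_step E Skip s 1 s"
| NAssign: "big_step E (NAssign a b) s 1
     (s\<lparr>nat_mem := (nat_mem s)(nval E s a := nval E s b)\<rparr>)"
| RAssign: "big_step E (RAssign a x) s 1
     (s\<lparr>real_mem := (real_mem s)(nval E s a := rval E s x)\<rparr>)"
| Serve: "big_step E (Serve a) s 1 (s\<lparr>served_now := insert (nval E s a) (served_now s)\<rparr>)"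
| Wakeup: "big_step E (Wakeup x) s 1 (s\<lparr>wakeup := Some (rval E s x)\<rparr>)"
| Seq: "big_step E P1 s m s' \<Longrightarrow> big_step E P2 s' n s'' \<Longrightarrow> big_step E (Seq P1 P2) s (m + n) s''"
| CondTrue: "bval E s b \<Longrightarrow> big_step E P1 s n s' \<Longrightarrow> big_step E (Cond b P1 P2) s (Suc n) s'"
| CondFalse: "\<not> bval E s b \<Longrightarrow> big_step E P2 s n s' \<Longrightarrow> big_step E (Cond b P1 P2) s (Suc n) s'"
| WhileFalse: "\<not> bval E s b \<Longrightarrow> big_step E (While b P) s 1 s"
| WhileTrue: "bval E s b \<Longrightarrow> big_step E P s m s' \<Longrightarrow> big_step E (While b P) s' n s'' \<Longrightarrow>
     big_step E (While b P) s (Suc (m + n)) s''"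

text \<open>
  The program runs at every arrival time, after all requests arriving at that time have been
  released, and at the wake-up time requested by its previous run unless an arrival comes first.
  Both memories persist between runs. A run that selects at least one request triggers a service of
  the selected requests at the current time; a wake-up request for a time that is not in the
  future is void.
\<close>

fun next_event :: "request list \<Rightarrow> nat \<Rightarrow> real option \<Rightarrow> real option" where
  "next_event \<sigma> r None = (if r < length \<sigma> then Some (arrival (\<sigma> ! r)) else None)"
| "next_event \<sigma> r (Some w) = (if r < length \<sigma> then Some (min w (arrival (\<sigma> ! r))) else Some w)"

definition released_by :: "request list \<Rightarrow> real \<Rightarrow> request list" where
  "released_by \<sigma> t = takeWhile (\<lambda>p. arrival p \<le> t) \<sigma>"

definition env_at :: "real \<Rightarrow> request list \<Rightarrow> real \<Rightarrow> env" where
  "env_at c \<sigma> t = \<lparr>service_cost = c, now = t, released = released_by \<sigma> t\<rparr>"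

definition service_of :: "real \<Rightarrow> state \<Rightarrow> schedule" where
  "service_of t s = (if served_now s = {} then [] else [(t, served_now s)])"

definition wakeup_after :: "real \<Rightarrow> state \<Rightarrow> real option" where
  "wakeup_after t s = (case wakeup s of None \<Rightarrow> None | Some w \<Rightarrow> if t < w then Some w else None)"

text \<open>
  In \<open>execution_from P c \<sigma> r w M R S n\<close>, \<open>r\<close> requests have been released, \<open>w\<close> is the pending wake-up
  time, \<open>M\<close> and \<open>R\<close> are the memories, and the remaining runs produce \<open>S\<close> in \<open>n\<close> steps in total.
\<close>

inductive execution_from ::
  "com \<Rightarrow> real \<Rightarrow> request list \<Rightarrow>
   nat \<Rightarrow> real option \<Rightarrow> (nat \<Rightarrow> nat) \<Rightarrow> (nat \<Rightarrow> real) \<Rightarrow> schedule \<Rightarrow> nat \<Rightarrow> bool"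
  for P c \<sigma> where
  Done: "next_event \<sigma> r w = None \<Longrightarrow> execution_from P c \<sigma> r w M R [] 0"
| Run: "next_event \<sigma> r w = Some t \<Longrightarrow>
     big_step (env_at c \<sigma> t) P
       \<lparr>nat_mem = M, real_mem = R, served_now = {}, wakeup = None\<rparr> m s \<Longrightarrow>
     execution_from P c \<sigma> (length (released_by \<sigma> t)) (wakeup_after t s)
       (nat_mem s) (real_mem s) S n \<Longrightarrow>
     execution_from P c \<sigma> r w M R (service_of t s @ S) (m + n)"

definition execution :: "com \<Rightarrow> real \<Rightarrow> request list \<Rightarrow> schedule \<Rightarrow> nat \<Rightarrow> bool" where
  "execution P c \<sigma> S n \<longleftrightarrow> execution_from P c \<sigma> 0 None (\<lambda>_. 0) (\<lambda>_. 0) S n"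

lemma big_step_deterministic:
  "big_step E P s m s' \<Longrightarrow> big_step E P s n s'' \<Longrightarrow> m = n \<and> s' = s''"
proof (induction arbitrary: n s'' rule: big_step.induct)
  case (Seq P1 s m s' P2 k t)
  from Seq.prems Seq.IH show ?case by (cases rule: big_step.cases) blast+
next
  case (WhileTrue s b P m s' k t)
  from WhileTrue.prems WhileTrue.hyps WhileTrue.IH show ?case
    by (cases rule: big_step.cases) blast+
next
  case (CondTrue s b P1 k s' P2)
  from CondTrue.prems CondTrue.hyps CondTrue.IH show ?case
    by (cases rule: big_step.cases) blast+
next
  case (CondFalse s b P2 k s' P1)
  from CondFalse.prems CondFalse.hyps CondFalse.IH show ?case
    by (cases rule: big_step.cases) blast+
qed (auto elim: big_step.cases)

lemma execution_from_deterministic: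
  "execution_from P c \<sigma> r w M R S n \<Longrightarrow> execution_from P c \<sigma> r w M R S' n' \<Longrightarrow> S = S' \<and> n = n'"
proof (induction arbitrary: S' n' rule: execution_from.induct)
  case (Done r w M R)
  then show ?case by (auto elim: execution_from.cases)
next
  case (Run r w t M R m s S n)
  from Run.prems Run.hyps(1) obtain m' s2 S2 n2 where
      bs: "big_step (env_at c \<sigma> t) P
        \<lparr>nat_mem = M, real_mem = R, served_now = {}, wakeup = None\<rparr> m' s2"
    and ex: "execution_from P c \<sigma> (length (released_by \<sigma> t)) (wakeup_after t s2)
        (nat_mem s2) (real_mem s2) S2 n2"
    and eq: "S' = service_of t s2 @ S2" "n' = m' + n2"
    by (cases rule: execution_from.cases) auto
  from big_step_deterministic[OF Run.hyps(2) bs] have "m' = m" "s2 = s" by auto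
  with Run.IH ex eq show ?case by auto
qed

lemma execution_deterministic:
  "execution P c \<sigma> S n \<Longrightarrow> execution P c \<sigma> S' n' \<Longrightarrow> S = S' \<and> n = n'"
  unfolding execution_def by (rule execution_from_deterministic)


section \<open>Running time and competitiveness\<close>

text \<open>The bound is on the total number of steps, over all runs on the request sequence.\<close>

definition polynomial_time :: "com \<Rightarrow> bool" where
  "polynomial_time P \<longleftrightarrow>
     (\<exists>q :: nat poly. \<forall>c > 0. \<forall>\<sigma>. request_sequence \<sigma> \<longrightarrow>
        (\<exists>S n. execution P c \<sigma> S n \<and> n \<le> poly q (length \<sigma>)))"

text \<open>By \<open>execution_deterministic\<close>, the schedule \<open>S\<close> below is the one computed by \<open>P\<close>.\<close>

definition competitive :: "real \<Rightarrow> com \<Rightarrow> bool" where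
  "competitive \<alpha> P \<longleftrightarrow>
     (\<forall>c > 0. \<forall>\<sigma>. request_sequence \<sigma> \<longrightarrow>
        (\<exists>S n. execution P c \<sigma> S n \<and> feasible \<sigma> S \<and> schedule_cost c \<sigma> S \<le> \<alpha> * OPT c \<sigma>))"

end

theory Submission
  imports Defs
begin

text \<open>
  Subtract from every cost function its unavoidable minimum, the value at the deadline. The algorithm
  serves at a time \<open>t\<close> at which the pending requests have total backlog at most \<open>2c\<close>, but at least
  \<open>c\<close> at every later time. The service satisfies all requests that are due. Among the others, the
  time until which the backlog cost does not exceed the current holding cost is the patience of
  a request; the requests are served early in order of patience, as long as their holding costs
  sum up to at most \<open>c\<close>. So a service accounts for a cost of at most \<open>c + 2c + c\<close>.

  A schedule without a service between two consecutive services \<open>l < t\<close> of the algorithm pays \<open>c\<close>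
  for requests. If \<open>t\<close> is less than the patience of all requests left over at \<open>l\<close>, the requests due at
  \<open>t\<close> cost at least their backlog just after \<open>t\<close>. Otherwise the requests of least patience, of which
  the algorithm could not serve all at \<open>l\<close>, cost more than \<open>c\<close>: they are served either until \<open>l\<close>
  or after their patience has expired. In both cases only requests are charged that were served by
  the algorithm early at \<open>l\<close> or when due at \<open>t\<close>, so that no request is charged twice.
\<close>

section \<open>Single requests\<close>

definition min_cost :: "request \<Rightarrow> real" where
  "min_cost p = cost_fun p (deadline p)"

text \<open>Continuing by 0 to the left of the deadline makes this monotone on the whole line,
  including times before the arrival, where \<open>cost_fun\<close> is unconstrained.\<close>

definition backlog :: "request \<Rightarrow> real \<Rightarrow> real" where
  "backlog p t = (if t < deadline p then 0 else cost_fun p t - min_cost p)"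

lemma valid_requestD:
  assumes "valid_request p"
  shows "arrival p \<le> deadline p"
    and "arrival p \<le> t \<Longrightarrow> 0 \<le> cost_fun p t"
    and "\<lbrakk>arrival p \<le> s; s \<le> t; t \<le> deadline p\<rbrakk> \<Longrightarrow> cost_fun p t \<le> cost_fun p s"
    and "\<lbrakk>deadline p \<le> s; s \<le> t\<rbrakk> \<Longrightarrow> cost_fun p s \<le> cost_fun p t"
    and "filterlim (cost_fun p) at_top at_top"
    and "deadline p < t \<Longrightarrow> continuous (at_left t) (cost_fun p)"
proof -
  have v: "antimono_on {arrival p..deadline p} (cost_fun p)" "mono_on {deadline p..} (cost_fun p)"
    using assms by (auto simp: valid_request_def)
  show "\<lbrakk>arrival p \<le> s; s \<le> t; t \<le> deadline p\<rbrakk> \<Longrightarrow> cost_fun p t \<le> cost_fun p s"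
    using monotone_onD[OF v(1), of s t] by auto
  show "\<lbrakk>deadline p \<le> s; s \<le> t\<rbrakk> \<Longrightarrow> cost_fun p s \<le> cost_fun p t"
    using mono_onD[OF v(2), of s t] by auto
qed (use assms in \<open>auto simp: valid_request_def\<close>)

lemma min_cost_nonneg: "valid_request p \<Longrightarrow> 0 \<le> min_cost p"
  by (simp add: min_cost_def valid_requestD)

lemma min_cost_le:
  assumes "valid_request p" "arrival p \<le> t"
  shows "min_cost p \<le> cost_fun p t"
  using valid_requestD(3)[OF assms(1), of t "deadline p"] valid_requestD(4)[OF assms(1), of "deadline p" t] assms(2)
  by (cases "t \<le> deadline p") (auto simp: min_cost_def)

lemma backlog_eq_0: "t \<le> deadline p \<Longrightarrow> backlog p t = 0"
  by (auto simp: backlog_def min_cost_def)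

lemma backlog_mono:
  assumes "valid_request p" "s \<le> t"
  shows "backlog p s \<le> backlog p t"
  using valid_requestD(4)[OF assms(1)] assms(2) by (auto simp: backlog_def min_cost_def)

lemma backlog_nonneg: "valid_request p \<Longrightarrow> 0 \<le> backlog p t"
  using valid_requestD(4)[of p "deadline p" t] by (auto simp: backlog_def min_cost_def)

text \<open>Unbounded backlog costs bound the set of times with cost at most \<open>v\<close>,
  left-continuity carries the bound over to its supremum, and by monotonicity the set is the whole
  interval from the deadline to the supremum.\<close>

lemma last_time:
  assumes p: "valid_request p" and v: "min_cost p \<le> v"
  shows deadline_le_last_time: "deadline p \<le> last_time p v"
    and cost_le_iff_last_time: "deadline p \<le> t \<Longrightarrow> cost_fun p t \<le> v \<longleftrightarrow> t \<le> last_time p v"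
proof -
  let ?S = "{t. deadline p \<le> t \<and> cost_fun p t \<le> v}"
  define L where "L = Sup ?S"
  have L: "last_time p v = L"
    using v by (simp add: last_time_def min_cost_def L_def)
  have d: "deadline p \<in> ?S" using v by (simp add: min_cost_def)
  have "eventually (\<lambda>t. v + 1 \<le> cost_fun p t) at_top"
    using valid_requestD(5)[OF p] by (simp add: filterlim_at_top)
  then obtain N where N: "\<And>t. N \<le> t \<Longrightarrow> v + 1 \<le> cost_fun p t"
    by (auto simp: eventually_at_top_linorder)
  have bdd: "bdd_above ?S"
  proof (rule bdd_aboveI)
    fix t assume "t \<in> ?S"
    then show "t \<le> N" using N[of t] by (cases "N \<le> t") auto
  qed
  have dL: "deadline p \<le> L" unfolding L_def by (rule cSup_upper[OF d bdd])
  have "cost_fun p L \<le> v"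
  proof (cases "L = deadline p")
    case True
    then show ?thesis using d by simp
  next
    case False
    with dL have less: "deadline p < L" by simp
    have lim: "(cost_fun p \<longlongrightarrow> cost_fun p L) (at_left L)"
      using valid_requestD(6)[OF p less] by (simp add: continuous_within)
    have "eventually (\<lambda>t. t \<in> {deadline p<..<L}) (at_left L)"
      by (rule eventually_at_leftI[OF _ less]) auto
    then have "eventually (\<lambda>t. cost_fun p t \<le> v) (at_left L)"
    proof eventually_elim
      case (elim t)
      then obtain u where "u \<in> ?S" "t < u"
        using less_cSupE[of t ?S] d by (auto simp: L_def)
      then show ?case using valid_requestD(4)[OF p, of t u] elim by auto
    qed
    then show ?thesis
      by (intro tendsto_upperbound[OF lim]) (auto simp: trivial_limit_at_left_real)
  qed
  then show "deadline p \<le> t \<Longrightarrow> cost_fun p t \<le> v \<longleftrightarrow> t \<le> last_time p v"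
    using cSup_upper[OF _ bdd, of t] valid_requestD(4)[OF p, of t L] by (fastforce simp: L L_def)
  show "deadline p \<le> last_time p v" using dL L by simp
qed

lemma backlog_le_iff_last_time:
  assumes "valid_request p" "0 \<le> v"
  shows "backlog p t \<le> v \<longleftrightarrow> t \<le> last_time p (min_cost p + v)"
  using deadline_le_last_time[OF assms(1), of "min_cost p + v"]
    cost_le_iff_last_time[OF assms(1), of "min_cost p + v" t] assms(2)
  by (auto simp: backlog_def)

text \<open>Used to pick a time just after \<open>t\<close>, before the next of finitely many
  events.\<close>

lemma finite_right_gap:
  fixes V :: "real set"
  assumes "finite V" "\<And>v. v \<in> V \<Longrightarrow> t < v"
  obtains t' where "t < t'" "\<And>v. v \<in> V \<Longrightarrow> t' \<le> v"
proof (rule that[of "Min (insert (t + 1) V)"])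
  show "t < Min (insert (t + 1) V)" using assms by (subst Min_gr_iff) auto
qed (use assms in auto)


section \<open>The threshold algorithm\<close>

locale jrp =
  fixes c :: real and \<sigma> :: "request list"
  assumes c_pos: "0 < c" and sequence: "request_sequence \<sigma>"
begin

lemma valid: "i < length \<sigma> \<Longrightarrow> valid_request (\<sigma> ! i)"
  using sequence by (auto simp: request_sequence_def)

definition pending :: "nat set \<Rightarrow> real \<Rightarrow> nat set" where
  "pending D t = {i. i < length \<sigma> \<and> arrival (\<sigma> ! i) \<le> t} - D"

lemma finite_pending [simp]: "finite (pending D t)"
  by (simp add: pending_def)

lemma valid_pending: "i \<in> pending D t \<Longrightarrow> valid_request (\<sigma> ! i)"
  by (simp add: pending_def valid)

definition total_backlog :: "nat set \<Rightarrow> real \<Rightarrow> real" where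
  "total_backlog U t = (\<Sum>i\<in>U. backlog (\<sigma> ! i) t)"

text \<open>The oracle inverts the backlog of one request, not a sum of backlogs. Therefore only the
  times at which a single backlog leaves a level \<open>j * c / r\<close> are examined. In use,
  \<open>r\<close> is the number of released requests, which keeps the candidates polynomially
  many.\<close>

definition level_time :: "nat \<Rightarrow> nat \<Rightarrow> nat \<Rightarrow> real" where
  "level_time r i j = last_time (\<sigma> ! i) (min_cost (\<sigma> ! i) + real j * c / real r)"

definition candidates :: "nat \<Rightarrow> nat set \<Rightarrow> real set" where
  "candidates r U = {X. total_backlog U X \<le> 2 * c \<and> (\<exists>i\<in>U. \<exists>j\<le>r. X = level_time r i j)}"

text \<open>The current time always competes: \<open>T = t\<close> says that no candidate lies in
  the future, and \<open>T > t\<close> is a time until which waiting is affordable.\<close>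

definition is_trigger :: "nat \<Rightarrow> nat set \<Rightarrow> real \<Rightarrow> real \<Rightarrow> bool" where
  "is_trigger r U t T \<longleftrightarrow> T \<in> insert t (candidates r U) \<and> (\<forall>X \<in> insert t (candidates r U). X \<le> T)"

definition holding :: "nat \<Rightarrow> real \<Rightarrow> real" where
  "holding i t = cost_fun (\<sigma> ! i) t - min_cost (\<sigma> ! i)"

text \<open>The time until which waiting beyond the deadline is no worse than being served at \<open>t\<close>.\<close>

definition patience :: "nat \<Rightarrow> real \<Rightarrow> real" where
  "patience i t = last_time (\<sigma> ! i) (cost_fun (\<sigma> ! i) t)"

text \<open>Ties in patience are counted, so that requests of equal patience are served early
  together or not at all.\<close>

definition early_load :: "nat set \<Rightarrow> real \<Rightarrow> nat \<Rightarrow> real" where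
  "early_load U t i =
     (\<Sum>k\<in>{k\<in>U. t < deadline (\<sigma> ! k) \<and> patience k t \<le> patience i t}. holding k t)"

definition batch :: "nat set \<Rightarrow> real \<Rightarrow> nat set" where
  "batch U t = {i\<in>U. t < deadline (\<sigma> ! i) \<longrightarrow> early_load U t i \<le> c}"

text \<open>Specification that separates the cost analysis from the program: \<open>l\<close> stands
  for the previous service time and \<open>D\<close> for the requests served so far.\<close>

fun threshold_schedule :: "real \<Rightarrow> nat set \<Rightarrow> schedule \<Rightarrow> bool" where
  "threshold_schedule l D [] \<longleftrightarrow> {..<length \<sigma>} \<subseteq> D"
| "threshold_schedule l D ((t, J) # S) \<longleftrightarrow>
     l < t \<and> J = batch (pending D t) t \<and> total_backlog (pending D t) t \<le> 2 * c \<and>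
     (\<forall>t'>t. c \<le> total_backlog (pending D t) t') \<and> threshold_schedule t (D \<union> J) S"

lemma total_backlog_mono:
  assumes "\<And>i. i \<in> U \<Longrightarrow> valid_request (\<sigma> ! i)" "s \<le> t"
  shows "total_backlog U s \<le> total_backlog U t"
  unfolding total_backlog_def using assms by (intro sum_mono backlog_mono) auto

text \<open>If the backlog at \<open>t'\<close> were below \<open>c\<close>, rounding every individual backlog up to a multiple of
  \<open>c / r\<close> would give a candidate at or after \<open>t'\<close>, because rounding adds at most \<open>c\<close> in total.\<close>

lemma trigger_backlog:
  assumes U: "U \<noteq> {}" "U \<subseteq> {..<r}" and r: "r \<le> length \<sigma>"
    and trig: "is_trigger r U t t" and t': "t < t'"
  shows "c \<le> total_backlog U t'"
proof (rule ccontr)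
  assume "\<not> ?thesis"
  then have less: "(\<Sum>i\<in>U. backlog (\<sigma> ! i) t') < c" by (simp add: total_backlog_def)
  have fin: "finite U" using U(2) finite_subset by blast
  have r0: "0 < r" using U by (cases r) auto
  have v: "valid_request (\<sigma> ! i)" if "i \<in> U" for i
    using that U r by (intro valid) auto
  \<comment> \<open>Index of the least level not below the backlog at \<open>t'\<close>; it is at
    most \<open>r\<close> because a single backlog is below \<open>c\<close>.\<close>
  define j where "j i = nat \<lceil>backlog (\<sigma> ! i) t' * real r / c\<rceil>" for i
  have j: "backlog (\<sigma> ! i) t' \<le> real (j i) * c / real r \<and>
      real (j i) * c / real r \<le> backlog (\<sigma> ! i) t' + c / real r \<and> j i \<le> r" if i: "i \<in> U" for i
  proof -
    let ?b = "backlog (\<sigma> ! i) t'"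
    have b0: "0 \<le> ?b" using v[OF i] by (rule backlog_nonneg)
    have "?b \<le> (\<Sum>i\<in>U. backlog (\<sigma> ! i) t')"
      by (rule member_le_sum[OF i _ fin]) (use v backlog_nonneg in auto)
    then have bc: "?b < c" using less by simp
    have x0: "0 \<le> ?b * real r / c" using b0 c_pos by simp
    have "?b * real r \<le> c * real r" using bc by (intro mult_right_mono) auto
    then have "?b * real r / c \<le> real r" using c_pos by (simp add: pos_divide_le_eq mult.commute)
    then have 1: "j i \<le> r" by (simp only: j_def nat_ceiling_le_eq)
    have "?b * real r / c \<le> real (j i)" "real (j i) \<le> ?b * real r / c + 1"
      using x0 unfolding j_def by linarith+
    then show ?thesis using 1 c_pos r0 by (simp add: field_simps)
  qed
  \<comment> \<open>At the earliest of these times every backlog is still within its own level, and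
    no level is exceeded before \<open>t'\<close>, so \<open>X\<close> is at least
    \<open>t'\<close>.\<close>
  define X where "X = Min ((\<lambda>i. level_time r i (j i)) ` U)"
  have "X \<in> (\<lambda>i. level_time r i (j i)) ` U"
    unfolding X_def using fin U(1) by (intro Min_in) auto
  then obtain i where i: "i \<in> U" "X = level_time r i (j i)" by auto
  have XU: "X \<le> level_time r k (j k)" if "k \<in> U" for k
    unfolding X_def using that fin by (intro Min_le) auto
  have nonneg: "0 \<le> real (j k) * c / real r" for k using c_pos by simp
  have "t' \<le> X"
    using backlog_le_iff_last_time[OF v[OF i(1)] nonneg, of t' i] j[OF i(1)]
    by (simp add: i(2) level_time_def)
  have "total_backlog U X \<le> (\<Sum>k\<in>U. backlog (\<sigma> ! k) t' + c / real r)"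
    unfolding total_backlog_def
  proof (rule sum_mono)
    fix k assume k: "k \<in> U"
    show "backlog (\<sigma> ! k) X \<le> backlog (\<sigma> ! k) t' + c / real r"
      using backlog_le_iff_last_time[OF v[OF k] nonneg, of X k] XU[OF k] j[OF k]
      by (auto simp: level_time_def)
  qed
  also have "\<dots> = (\<Sum>k\<in>U. backlog (\<sigma> ! k) t') + real (card U) * (c / real r)"
    by (simp add: sum.distrib)
  also have "\<dots> \<le> c + real r * (c / real r)"
    using less card_mono[OF _ U(2)] c_pos by (intro add_mono mult_right_mono) auto
  also have "\<dots> = 2 * c" using r0 by simp
  finally have "X \<in> candidates r U" using i j[OF i(1)] by (auto simp: candidates_def)
  then have "X \<le> t" using trig by (auto simp: is_trigger_def)
  then show False using \<open>t' \<le> X\<close> t' by simp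
qed

text \<open>If nothing were due, all backlogs would still be 0 shortly after \<open>t\<close>,
  contradicting \<open>c > 0\<close>. Hence a triggered service is never empty.\<close>

lemma trigger_imp_due:
  assumes U: "finite U" and c: "\<And>t'. t < t' \<Longrightarrow> c \<le> total_backlog U t'"
  obtains i where "i \<in> U" "deadline (\<sigma> ! i) \<le> t"
proof (rule ccontr)
  assume "\<not> thesis"
  then have less: "\<And>i. i \<in> U \<Longrightarrow> t < deadline (\<sigma> ! i)" using that by force
  obtain t' where t': "t < t'" "\<And>v. v \<in> (\<lambda>i. deadline (\<sigma> ! i)) ` U \<Longrightarrow> t' \<le> v"
    by (rule finite_right_gap[of "(\<lambda>i. deadline (\<sigma> ! i)) ` U" t]) (use U less in auto)
  then have "total_backlog U t' = 0" by (auto simp: total_backlog_def backlog_eq_0)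
  then show False using c[OF t'(1)] c_pos by simp
qed

section \<open>Cost and feasibility of threshold schedules\<close>

lemma batch_due: "\<lbrakk>i \<in> U; deadline (\<sigma> ! i) \<le> t\<rbrakk> \<Longrightarrow> i \<in> batch U t"
  by (auto simp: batch_def)

lemma batch_subset: "batch U t \<subseteq> U"
  by (auto simp: batch_def)

lemma holding_nonneg: "\<lbrakk>i < length \<sigma>; arrival (\<sigma> ! i) \<le> t\<rbrakk> \<Longrightarrow> 0 \<le> holding i t"
  using min_cost_le[OF valid] by (simp add: holding_def)

text \<open>The early request of greatest patience has an \<open>early_load\<close> that covers the
  whole early part of the batch.\<close>

lemma batch_holding:
  shows "(\<Sum>i\<in>{i\<in>batch (pending D t) t. t < deadline (\<sigma> ! i)}. holding i t) \<le> c" (is "sum _ ?E \<le> c")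
proof (cases "?E = {}")
  case False
  have fin: "finite ?E"
    by (rule finite_subset[OF _ finite_pending[of D t]]) (auto simp: batch_def)
  have "Max ((\<lambda>i. patience i t) ` ?E) \<in> (\<lambda>i. patience i t) ` ?E" using fin False by (intro Max_in) auto
  then obtain i where i: "i \<in> ?E" and pi: "patience i t = Max ((\<lambda>i. patience i t) ` ?E)" by auto
  have max: "patience k t \<le> patience i t" if "k \<in> ?E" for k
    unfolding pi using fin that by (intro Max_ge) auto
  have "sum (\<lambda>i. holding i t) ?E \<le> early_load (pending D t) t i"
    unfolding early_load_def
  proof (rule sum_mono2)
    show "?E \<subseteq> {k \<in> pending D t. t < deadline (\<sigma> ! k) \<and> patience k t \<le> patience i t}"
      using batch_subset max by fastforce
  qed (auto simp: pending_def intro: holding_nonneg)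
  also have "\<dots> \<le> c" using i by (auto simp: batch_def)
  finally show ?thesis .
next
  case True
  then show ?thesis using c_pos by (simp only: sum.empty)
qed

lemma batch_cost:
  assumes "total_backlog (pending D t) t \<le> 2 * c"
  shows "(\<Sum>i\<in>batch (pending D t) t. cost_fun (\<sigma> ! i) t)
    \<le> 3 * c + (\<Sum>i\<in>batch (pending D t) t. min_cost (\<sigma> ! i))"
proof -
  let ?J = "batch (pending D t) t"
  let ?E = "{i\<in>?J. t < deadline (\<sigma> ! i)}" and ?F = "{i\<in>?J. deadline (\<sigma> ! i) \<le> t}"
  have fin: "finite ?J" using batch_subset finite_pending finite_subset by blast
  have J: "?J = ?E \<union> ?F" by auto
  have "(\<Sum>i\<in>?J. cost_fun (\<sigma> ! i) t) - (\<Sum>i\<in>?J. min_cost (\<sigma> ! i)) = (\<Sum>i\<in>?J. holding i t)"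
    by (simp add: holding_def sum_subtractf)
  also have "\<dots> = (\<Sum>i\<in>?E. holding i t) + (\<Sum>i\<in>?F. holding i t)"
    by (subst (1) J, rule sum.union_disjoint) (use fin in auto)
  also have "(\<Sum>i\<in>?F. holding i t) = (\<Sum>i\<in>?F. backlog (\<sigma> ! i) t)"
    by (rule sum.cong) (auto simp: holding_def backlog_def)
  also have "\<dots> \<le> total_backlog (pending D t) t"
    unfolding total_backlog_def using batch_subset
    by (intro sum_mono2) (auto intro!: backlog_nonneg valid_pending)
  finally show ?thesis using assms batch_holding[of t D] by simp
qed

text \<open>Each service costs \<open>c\<close> itself and \<open>3 * c\<close> by
  \<open>batch_cost\<close>. The minimum costs stay separate, since every schedule has to pay
  them.\<close>

lemma threshold_schedule_cost:
  "threshold_schedule l D S \<Longrightarrow>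
    schedule_cost c \<sigma> S \<le> 4 * c * real (length S) + (\<Sum>i\<in>{..<length \<sigma>} - D. min_cost (\<sigma> ! i))"
proof (induction S arbitrary: l D)
  case (Cons a S)
  obtain t J where a: "a = (t, J)" by force
  let ?n = "{..<length \<sigma>}"
  have J: "J = batch (pending D t) t" and T: "threshold_schedule t (D \<union> J) S"
    and B: "total_backlog (pending D t) t \<le> 2 * c" using Cons.prems a by auto
  have JU: "J \<subseteq> ?n - D" using batch_subset[of "pending D t" t] J by (auto simp: pending_def)
  have eq: "?n - D = J \<union> (?n - (D \<union> J))" using JU by auto
  have "(\<Sum>i\<in>?n - D. min_cost (\<sigma> ! i)) =
      (\<Sum>i\<in>J. min_cost (\<sigma> ! i)) + (\<Sum>i\<in>?n - (D \<union> J). min_cost (\<sigma> ! i))"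
    using finite_subset[OF JU] by (subst eq, intro sum.union_disjoint) auto
  then show ?case
    using Cons.IH[OF T] batch_cost[OF B] by (simp add: a schedule_cost_def J algebra_simps)
qed (auto simp: schedule_cost_def intro!: sum_nonneg min_cost_nonneg valid)

text \<open>The additional claim \<open>i \<notin> D\<close> makes the induction work: later
  services avoid everything served before.\<close>

lemma threshold_schedule_feasible:
  "threshold_schedule l D S \<Longrightarrow>
    (\<forall>(t, J) \<in> set S. \<forall>i \<in> J. i < length \<sigma> \<and> arrival (\<sigma> ! i) \<le> t \<and> i \<notin> D) \<and>
    (\<forall>i < length \<sigma>. i \<notin> D \<longrightarrow> (\<exists>!k. k < length S \<and> i \<in> snd (S ! k)))"
proof (induction S arbitrary: l D)
  case (Cons a S)
  obtain t J where a: "a = (t, J)" by force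
  have J: "J = batch (pending D t) t" and T: "threshold_schedule t (D \<union> J) S"
    using Cons.prems a by auto
  have JU: "\<forall>i\<in>J. i < length \<sigma> \<and> arrival (\<sigma> ! i) \<le> t \<and> i \<notin> D"
    using batch_subset[of "pending D t" t] J by (auto simp: pending_def)
  note IH = conjunct1[OF Cons.IH[OF T]] conjunct2[OF Cons.IH[OF T], rule_format]
  have sound: "\<forall>(t, J) \<in> set (a # S). \<forall>i \<in> J. i < length \<sigma> \<and> arrival (\<sigma> ! i) \<le> t \<and> i \<notin> D"
    using IH(1) JU a by fastforce
  have ex: "\<exists>!k. k < length (a # S) \<and> i \<in> snd ((a # S) ! k)" if i: "i < length \<sigma>" "i \<notin> D" for i
  proof (cases "i \<in> J")
    case True
    have "i \<notin> snd (S ! k)" if "k < length S" for k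
      using IH(1) True nth_mem[OF that] by (cases "S ! k") fastforce
    then show ?thesis using True a
      by (intro ex1I[of _ 0]) (auto simp: nth_Cons split: nat.splits)
  next
    case False
    have ex1: "\<exists>!k. k < length S \<and> i \<in> snd (S ! k)" using False i by (intro IH(2)) auto
    then obtain k where k: "k < length S" "i \<in> snd (S ! k)" by (elim ex1E conjE)
    show ?thesis
    proof (rule ex1I[of _ "Suc k"])
      fix k' assume "k' < length (a # S) \<and> i \<in> snd ((a # S) ! k')"
      then obtain k'' where "k' = Suc k''" "k'' < length S" "i \<in> snd (S ! k'')"
        using False a by (cases k') auto
      then show "k' = Suc k" using ex1 k by blast
    qed (use k in auto)
  qed
  show ?case using sound ex by (intro conjI allI impI)
qed auto


section \<open>The lower bound on the optimum\<close>

definition excess :: "(nat \<Rightarrow> real) \<Rightarrow> nat \<Rightarrow> real" where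
  "excess s i = cost_fun (\<sigma> ! i) (s i) - min_cost (\<sigma> ! i)"

text \<open>After a service at time \<open>l\<close>, \<open>R\<close> is the set of requests served early and \<open>D\<close> the set of all
  requests served so far.\<close>

definition after_service :: "real \<Rightarrow> nat set \<Rightarrow> nat set \<Rightarrow> bool" where
  "after_service l D R \<longleftrightarrow>
     R \<subseteq> D \<and> (\<forall>i\<in>R \<union> pending D l. i < length \<sigma> \<and> arrival (\<sigma> ! i) \<le> l \<and> l < deadline (\<sigma> ! i)) \<and>
     (\<forall>i\<in>pending D l.
        c < (\<Sum>k\<in>{k \<in> R \<union> pending D l. patience k l \<le> patience i l}. holding k l))"

text \<open>Requests served early and leftovers together are the requests not yet due, so the sum in
  \<open>after_service\<close> is \<open>early_load\<close>, which exceeds \<open>c\<close> exactly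
  for the leftovers.\<close>

lemma after_service_batch:
  assumes "U = pending D t" "J = batch U t"
  shows "after_service t (D \<union> J) {i \<in> J. t < deadline (\<sigma> ! i)}"
proof -
  let ?R = "{i \<in> J. t < deadline (\<sigma> ! i)}"
  have P: "pending (D \<union> J) t = U - J" using assms by (auto simp: pending_def)
  have "?R \<union> (U - J) = {i \<in> U. t < deadline (\<sigma> ! i)}"
    using assms by (auto simp: batch_def)
  then have "{k \<in> ?R \<union> (U - J). patience k t \<le> patience i t} =
      {k\<in>U. t < deadline (\<sigma> ! k) \<and> patience k t \<le> patience i t}" for i
    by auto
  moreover have "c < early_load U t i" if "i \<in> U - J" for i
    using that assms by (auto simp: batch_def)
  ultimately show ?thesis unfolding after_service_def P early_load_def
    using assms by (auto simp: batch_def pending_def)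
qed

section \<open>Charging a competitor that serves request \<open>i\<close> at time
  \<open>s i\<close>, within a finite set \<open>\<Theta>\<close> of times\<close>

context
  fixes s :: "nat \<Rightarrow> real" and \<Theta> :: "real set"
  assumes s: "\<And>i. i < length \<sigma> \<Longrightarrow> arrival (\<sigma> ! i) \<le> s i \<and> s i \<in> \<Theta>" and finite_times: "finite \<Theta>"
begin

lemma excess_nonneg: "i < length \<sigma> \<Longrightarrow> 0 \<le> excess s i"
  using min_cost_le[OF valid] s by (simp add: excess_def)

lemma interval_lower_bound:
  assumes after: "after_service l D R" and lt: "l < t"
    and U: "U = pending D t" and trig: "\<And>t'. t < t' \<Longrightarrow> c \<le> total_backlog U t'"
  shows "c \<le> c * real (card (\<Theta> \<inter> {l<..t})) + (\<Sum>i\<in>R \<union> {i\<in>U. deadline (\<sigma> ! i) \<le> t}. excess s i)"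
    (is "_ \<le> _ + sum _ (R \<union> ?W)")
proof -
  let ?P = "pending D l"
  have R: "i < length \<sigma>" "arrival (\<sigma> ! i) \<le> l" "l < deadline (\<sigma> ! i)" if "i \<in> R \<union> ?P" for i
    using after that by (auto simp: after_service_def)
  have Un: "i < length \<sigma>" "arrival (\<sigma> ! i) \<le> t" "i \<notin> D" if "i \<in> U" for i
    using U that by (auto simp: pending_def)
  have PU: "?P \<subseteq> U" using U lt by (auto simp: pending_def)
  have "finite R" by (rule finite_subset[of _ "{..<length \<sigma>}"]) (use R in auto)
  then have fin: "finite (R \<union> ?W)" using U by simp
  have nonneg: "0 \<le> excess s i" if "i \<in> R \<union> ?W" for i
    using excess_nonneg R(1) Un(1) that by blast
  have hold: "holding i l \<le> excess s i" if "i \<in> R \<union> ?P" "s i \<le> l" for i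
    using valid_requestD(3)[OF valid[OF R(1)], of i "s i" l] s R that
    by (force simp: holding_def excess_def)
  show ?thesis
  proof (cases "\<Theta> \<inter> {l<..t} = {}")
    case False
    \<comment> \<open>A service of the competitor between \<open>l\<close> and \<open>t\<close>
      already pays \<open>c\<close>.\<close>
    then have "1 \<le> card (\<Theta> \<inter> {l<..t})" using finite_times by (simp add: Suc_le_eq card_gt_0_iff)
    then have "c * 1 \<le> c * real (card (\<Theta> \<inter> {l<..t}))" using c_pos by (intro mult_left_mono) auto
    moreover have "0 \<le> sum (excess s) (R \<union> ?W)" by (rule sum_nonneg) (rule nonneg)
    ultimately show ?thesis by linarith
  next
    case True
    then have st: "s i \<le> l \<or> t < s i" if "i < length \<sigma>" for i
      using s[OF that] by force
    have "c \<le> sum (excess s) (R \<union> ?W)"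
    proof (cases "\<exists>p\<in>?P. patience p l \<le> t")
      case True
      then obtain p where p: "p \<in> ?P" "patience p l \<le> t" by auto
      \<comment> \<open>By \<open>after_service\<close>, the holding costs of \<open>?Q\<close> at
        \<open>l\<close> exceed \<open>c\<close>. The competitor serves each of these requests up to
        \<open>l\<close>, or after \<open>t\<close> and thus after its patience; either way it pays
        at least the holding cost at \<open>l\<close>.\<close>
      let ?Q = "{k \<in> R \<union> ?P. patience k l \<le> patience p l}"
      have pat: "min_cost (\<sigma> ! k) \<le> cost_fun (\<sigma> ! k) l" if "k \<in> R \<union> ?P" for k
        using min_cost_le[OF valid] R that by simp
      have "c \<le> (\<Sum>k\<in>?Q. holding k l)"
        using after p(1) unfolding after_service_def by (meson less_imp_le)
      also have "\<dots> \<le> (\<Sum>k\<in>?Q. excess s k)"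
      proof (rule sum_mono)
        fix k assume "k \<in> ?Q"
        then have k: "k \<in> R \<union> ?P" "patience k l \<le> t" using p(2) by auto
        show "holding k l \<le> excess s k"
        proof (cases "s k \<le> l")
          case False
          then have "t < s k" using st R(1)[OF k(1)] by auto
          then show ?thesis
            using cost_le_iff_last_time[OF valid[OF R(1)[OF k(1)]] pat[OF k(1)], of "s k"]
              deadline_le_last_time[OF valid[OF R(1)[OF k(1)]] pat[OF k(1)]] k(2)
            by (auto simp: holding_def excess_def patience_def)
        qed (use hold k in auto)
      qed
      also have "\<dots> \<le> sum (excess s) (R \<union> ?W)"
      proof (rule sum_mono2[OF fin])
        \<comment> \<open>Patience does not end before the deadline, so every leftover in
          \<open>?Q\<close> is due at \<open>t\<close>.\<close>
        show "?Q \<subseteq> R \<union> ?W"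
        proof
          fix k assume "k \<in> ?Q"
          then have k: "k \<in> R \<union> ?P" "patience k l \<le> t" using p(2) by auto
          then have "deadline (\<sigma> ! k) \<le> t"
            using deadline_le_last_time[OF valid[OF R(1)[OF k(1)]] pat[OF k(1)]]
            by (simp add: patience_def)
          then show "k \<in> R \<union> ?W" using k PU by auto
        qed
      qed (use nonneg in auto)
      finally show ?thesis .
    next
      case False
      \<comment> \<open>Up to \<open>t'\<close> no further deadline passes, no patience of a
        leftover runs out, and the competitor has no service of a request in \<open>U\<close>
        strictly between \<open>t\<close> and \<open>t'\<close>.\<close>
      let ?V = "{v \<in> s ` U. t < v} \<union> (\<lambda>i. patience i l) ` ?P \<union> {v \<in> (\<lambda>i. deadline (\<sigma> ! i)) ` U. t < v}"
      obtain t' where t': "t < t'" "\<And>v. v \<in> ?V \<Longrightarrow> t' \<le> v"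
        by (rule finite_right_gap[of ?V t]) (use U False in auto)
      have "c \<le> total_backlog U t'" using trig t' by blast
      also have "\<dots> = (\<Sum>i\<in>?W. backlog (\<sigma> ! i) t')"
        unfolding total_backlog_def
      proof (intro sum.mono_neutral_right ballI)
        fix i assume "i \<in> U - ?W"
        then have "deadline (\<sigma> ! i) \<in> ?V" by auto
        then show "backlog (\<sigma> ! i) t' = 0" by (intro backlog_eq_0 t'(2))
      qed (use U in auto)
      also have "\<dots> \<le> sum (excess s) ?W"
      proof (rule sum_mono)
        fix i assume "i \<in> ?W"
        then have i: "i \<in> U" "deadline (\<sigma> ! i) \<le> t" by auto
        note v = valid[OF Un(1)[OF i(1)]]
        show "backlog (\<sigma> ! i) t' \<le> excess s i"
        proof (cases "s i \<le> l")
          case True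
          \<comment> \<open>A request served by the competitor up to \<open>l\<close> had arrived by
            then and is a leftover. Its patience lasts until \<open>t'\<close>, so its backlog at
            \<open>t'\<close> is at most its holding cost at \<open>l\<close>.\<close>
          then have P: "i \<in> ?P" using s[OF Un(1)[OF i(1)]] Un[OF i(1)] by (auto simp: pending_def)
          then have "t' \<le> patience i l" using t' by auto
          then have "cost_fun (\<sigma> ! i) t' \<le> cost_fun (\<sigma> ! i) l"
            using cost_le_iff_last_time[OF v, of "cost_fun (\<sigma> ! i) l" t'] min_cost_le[OF v, of l] R P i t'(1)
            by (auto simp: patience_def)
          then show ?thesis using hold[of i] P True i t'(1) by (auto simp: backlog_def holding_def)
        next
          case False
          then have "t < s i" using st Un(1)[OF i(1)] by auto
          then have "t' \<le> s i" using t'(2)[of "s i"] i by auto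
          then show ?thesis using valid_requestD(4)[OF v, of t' "s i"] i t'(1)
            by (auto simp: backlog_def excess_def)
        qed
      qed
      also have "\<dots> \<le> sum (excess s) (R \<union> ?W)" by (rule sum_mono2[OF fin]) (use nonneg in auto)
      finally show ?thesis .
    qed
    moreover have "0 \<le> c * real (card (\<Theta> \<inter> {l<..t}))" using c_pos by simp
    ultimately show ?thesis by linarith
  qed
qed

text \<open>Each service is charged to the interval since the previous one. \<open>R\<close> occurs
  in the bound because requests served early at \<open>l\<close> are charged only by the interval
  that follows.\<close>

lemma threshold_schedule_lower_bound:
  "threshold_schedule l D S \<Longrightarrow> after_service l D R \<Longrightarrow>
    c * real (length S) \<le> c * real (card (\<Theta> \<inter> {l<..})) + (\<Sum>i\<in>R \<union> ({..<length \<sigma>} - D). excess s i)"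
proof (induction S arbitrary: l D R)
  case Nil
  have "0 \<le> (\<Sum>i\<in>R \<union> ({..<length \<sigma>} - D). excess s i)"
    using Nil.prems by (intro sum_nonneg excess_nonneg) (auto simp: after_service_def)
  then show ?case using c_pos by simp
next
  case (Cons a S)
  obtain t J where a: "a = (t, J)" by force
  let ?n = "{..<length \<sigma>}" and ?U = "pending D t"
  have J: "J = batch ?U t" and T: "threshold_schedule t (D \<union> J) S" and lt: "l < t"
    and trig: "\<And>t'. t < t' \<Longrightarrow> c \<le> total_backlog ?U t'" using Cons.prems a by auto
  let ?R = "{i \<in> J. t < deadline (\<sigma> ! i)}" and ?W = "{i\<in>?U. deadline (\<sigma> ! i) \<le> t}"
  have R: "R \<subseteq> D" "R \<subseteq> ?n" using Cons.prems(2) by (auto simp: after_service_def)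
  have JU: "J \<subseteq> ?n - D" using batch_subset[of ?U t] J by (auto simp: pending_def)
  have W: "?W = {i \<in> J. deadline (\<sigma> ! i) \<le> t}" using J by (auto simp: batch_def)
  have finR: "finite R" "finite J" using R JU finite_subset by blast+
  \<comment> \<open>Requests due at \<open>t\<close> are charged now; those served early at
    \<open>t\<close> become the next \<open>R\<close>.\<close>
  have eq: "R \<union> (?n - D) = (R \<union> ?W) \<union> (?R \<union> (?n - (D \<union> J)))"
    using JU W by auto
  have "(\<Sum>i\<in>R \<union> (?n - D). excess s i) =
      (\<Sum>i\<in>R \<union> ?W. excess s i) + (\<Sum>i\<in>?R \<union> (?n - (D \<union> J)). excess s i)"
    unfolding eq using R JU W finR by (intro sum.union_disjoint) auto
  moreover have "card (\<Theta> \<inter> {l<..}) = card (\<Theta> \<inter> {l<..t}) + card (\<Theta> \<inter> {t<..})"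
  proof -
    have "\<Theta> \<inter> {l<..} = (\<Theta> \<inter> {l<..t}) \<union> (\<Theta> \<inter> {t<..})" using lt by auto
    moreover have "card ((\<Theta> \<inter> {l<..t}) \<union> (\<Theta> \<inter> {t<..})) = card (\<Theta> \<inter> {l<..t}) + card (\<Theta> \<inter> {t<..})"
      using finite_times by (intro card_Un_disjoint) auto
    ultimately show ?thesis by presburger
  qed
  ultimately show ?case
    using Cons.IH[OF T after_service_batch[OF refl J]]
      interval_lower_bound[OF Cons.prems(2) lt refl trig]
    by (simp add: a algebra_simps)
qed

end

section \<open>Comparison with the infimum over all feasible schedules\<close>

lemma feasible_assignment:
  assumes "feasible \<sigma> Q"
  obtains s where "\<And>i. i < length \<sigma> \<Longrightarrow> arrival (\<sigma> ! i) \<le> s i \<and> s i \<in> set (map fst Q)"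
    and "schedule_cost c \<sigma> Q = c * real (length Q) + (\<Sum>i<length \<sigma>. cost_fun (\<sigma> ! i) (s i))"
proof -
  have J: "\<And>k i. k < length Q \<Longrightarrow> i \<in> snd (Q ! k) \<Longrightarrow> i < length \<sigma> \<and> arrival (\<sigma> ! i) \<le> fst (Q ! k)"
    using assms nth_mem unfolding feasible_def by (metis (no_types, lifting) case_prod_unfold)
  define \<kappa> where "\<kappa> i = (THE k. k < length Q \<and> i \<in> snd (Q ! k))" for i
  have ex: "\<exists>!k. k < length Q \<and> i \<in> snd (Q ! k)" if "i < length \<sigma>" for i
    using assms that by (auto simp: feasible_def)
  have \<kappa>: "\<kappa> i < length Q" "i \<in> snd (Q ! \<kappa> i)" if "i < length \<sigma>" for i
    using theI'[OF ex[OF that]] by (auto simp: \<kappa>_def)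
  have \<kappa>_eq: "k = \<kappa> i" if "i < length \<sigma>" "k < length Q" "i \<in> snd (Q ! k)" for i k
    using ex[OF that(1)] \<kappa>[OF that(1)] that by blast
  let ?s = "\<lambda>i. fst (Q ! \<kappa> i)"
  have "(\<Sum>(t, J)\<leftarrow>Q. \<Sum>i\<in>J. cost_fun (\<sigma> ! i) t) =
      (\<Sum>k<length Q. \<Sum>i\<in>snd (Q ! k). cost_fun (\<sigma> ! i) (fst (Q ! k)))"
    by (simp add: sum_list_sum_nth case_prod_unfold atLeast0LessThan)
  \<comment> \<open>Request \<open>i\<close> belongs to the single service
    \<open>\<kappa> i\<close>; with this as an indicator the two sums can be exchanged.\<close>
  also have "\<dots> = (\<Sum>k<length Q. \<Sum>i<length \<sigma>. if k = \<kappa> i then cost_fun (\<sigma> ! i) (?s i) else 0)"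
  proof (rule sum.cong[OF refl])
    fix k assume k: "k \<in> {..<length Q}"
    have "snd (Q ! k) = {i \<in> {..<length \<sigma>}. k = \<kappa> i}"
      using J k \<kappa> \<kappa>_eq by auto
    then show "(\<Sum>i\<in>snd (Q ! k). cost_fun (\<sigma> ! i) (fst (Q ! k))) =
      (\<Sum>i<length \<sigma>. if k = \<kappa> i then cost_fun (\<sigma> ! i) (?s i) else 0)"
      by (simp add: sum.inter_filter[symmetric])
  qed
  also have "\<dots> = (\<Sum>i<length \<sigma>. \<Sum>k<length Q. if k = \<kappa> i then cost_fun (\<sigma> ! i) (?s i) else 0)"
    by (rule sum.swap)
  also have "\<dots> = (\<Sum>i<length \<sigma>. cost_fun (\<sigma> ! i) (?s i))"
    using \<kappa> by (intro sum.cong) auto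
  finally show ?thesis
    using \<kappa> J by (intro that[of ?s]) (auto simp: schedule_cost_def)
qed

text \<open>Every feasible schedule pays all minimum costs \<open>?m\<close> and, by the charging
  argument, at least \<open>c\<close> per service of \<open>S\<close>. The cost of \<open>S\<close>
  is at most \<open>4 * c\<close> per service plus \<open>?m\<close>.\<close>

lemma threshold_schedule_competitive:
  assumes S: "threshold_schedule l {} S" and l: "\<And>i. i < length \<sigma> \<Longrightarrow> l < arrival (\<sigma> ! i)"
  shows "feasible \<sigma> S" and "schedule_cost c \<sigma> S \<le> 4 * OPT c \<sigma>"
proof -
  show feas: "feasible \<sigma> S"
    using threshold_schedule_feasible[OF S] by (simp add: feasible_def case_prod_unfold)
  let ?m = "\<Sum>i<length \<sigma>. min_cost (\<sigma> ! i)"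
  have after: "after_service l {} {}"
    using l by (fastforce simp: after_service_def pending_def)
  have "c * real (length S) + ?m \<le> OPT c \<sigma>"
    unfolding OPT_def
  proof (rule cINF_greatest)
    fix Q assume "Q \<in> {S. feasible \<sigma> S}"
    then obtain s where s: "\<And>i. i < length \<sigma> \<Longrightarrow> arrival (\<sigma> ! i) \<le> s i \<and> s i \<in> set (map fst Q)"
      and cost: "schedule_cost c \<sigma> Q = c * real (length Q) + (\<Sum>i<length \<sigma>. cost_fun (\<sigma> ! i) (s i))"
      using feasible_assignment by blast
    have "card (set (map fst Q) \<inter> {l<..}) \<le> length Q"
      by (metis List.finite_set card_length card_mono inf_le1 le_trans length_map)
    then have "c * real (card (set (map fst Q) \<inter> {l<..})) \<le> c * real (length Q)"
      using c_pos by (intro mult_left_mono) auto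
    then show "c * real (length S) + ?m \<le> schedule_cost c \<sigma> Q"
      using threshold_schedule_lower_bound[OF s finite_set S after]
      by (simp add: cost excess_def sum_subtractf)
  \<comment> \<open>\<open>S\<close> itself shows that the infimum ranges over a nonempty
    set.\<close>
  qed (use feas in auto)
  moreover have "0 \<le> ?m" by (intro sum_nonneg min_cost_nonneg valid) auto
  ultimately show "schedule_cost c \<sigma> S \<le> 4 * OPT c \<sigma>"
    using threshold_schedule_cost[OF S] by simp
qed

end

section \<open>Total correctness of programs with time bounds\<close>

text \<open>\<open>K\<close> is only an upper bound, so that both branches of a test can share
  it.\<close>

definition achieves :: "env \<Rightarrow> com \<Rightarrow> state \<Rightarrow> nat \<Rightarrow> (state \<Rightarrow> bool) \<Rightarrow> bool" where
  "achieves E P s K Q \<longleftrightarrow> (\<exists>m s'. big_step E P s m s' \<and> m \<le> K \<and> Q s')"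

lemma achieves_weaken:
  "achieves E P s K Q \<Longrightarrow> (\<And>s'. Q s' \<Longrightarrow> Q' s') \<Longrightarrow> achieves E P s K Q'"
  unfolding achieves_def by blast

lemma achieves_Skip: "Q s \<Longrightarrow> 1 \<le> K \<Longrightarrow> achieves E Skip s K Q"
  unfolding achieves_def using big_step.Skip by blast

lemma achieves_NAssign:
  "Q (s\<lparr>nat_mem := (nat_mem s)(nval E s a := nval E s b)\<rparr>) \<Longrightarrow> achieves E (NAssign a b) s 1 Q"
  unfolding achieves_def using big_step.NAssign by blast

lemma achieves_RAssign:
  "Q (s\<lparr>real_mem := (real_mem s)(nval E s a := rval E s x)\<rparr>) \<Longrightarrow> achieves E (RAssign a x) s 1 Q"
  unfolding achieves_def using big_step.RAssign by blast

lemma achieves_Serve: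
  "Q (s\<lparr>served_now := insert (nval E s a) (served_now s)\<rparr>) \<Longrightarrow> achieves E (Serve a) s 1 Q"
  unfolding achieves_def using big_step.Serve by blast

lemma achieves_Wakeup:
  "Q (s\<lparr>wakeup := Some (rval E s x)\<rparr>) \<Longrightarrow> achieves E (Wakeup x) s 1 Q"
  unfolding achieves_def using big_step.Wakeup by blast

text \<open>The run of the second command is the postcondition of the first, so no intermediate
  assertion has to be found.\<close>

lemma achieves_Seq:
  assumes "achieves E P1 s K1 (\<lambda>s'. achieves E P2 s' K2 Q)"
  shows "achieves E (Seq P1 P2) s (K1 + K2) Q"
proof -
  obtain m1 s1 m2 s2 where "big_step E P1 s m1 s1" "m1 \<le> K1" "big_step E P2 s1 m2 s2" "m2 \<le> K2" "Q s2"
    using assms unfolding achieves_def by blast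
  then show ?thesis unfolding achieves_def
    by (intro exI[of _ "m1 + m2"] exI[of _ s2]) (auto intro: big_step.Seq)
qed

lemma achieves_Cond:
  assumes "bval E s b \<Longrightarrow> achieves E P1 s K Q" "\<not> bval E s b \<Longrightarrow> achieves E P2 s K Q"
  shows "achieves E (Cond b P1 P2) s (1 + K) Q"
proof (cases "bval E s b")
  case True
  then obtain m s' where "big_step E P1 s m s'" "m \<le> K" "Q s'"
    using assms(1) unfolding achieves_def by blast
  then show ?thesis using True unfolding achieves_def
    by (intro exI[of _ "Suc m"] exI[of _ s']) (auto intro: big_step.CondTrue)
next
  case False
  then obtain m s' where "big_step E P2 s m s'" "m \<le> K" "Q s'"
    using assms(2) unfolding achieves_def by blast
  then show ?thesis using False unfolding achieves_def
    by (intro exI[of _ "Suc m"] exI[of _ s']) (auto intro: big_step.CondFalse)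
qed

definition for_loop :: "nat \<Rightarrow> nexp \<Rightarrow> com \<Rightarrow> com" where
  "for_loop v b P = Seq (NAssign (NConst v) (NConst 0))
     (While (NLess (NMem (NConst v)) b)
       (Seq P (NAssign (NConst v) (NPlus (NMem (NConst v)) (NConst 1)))))"

text \<open>The constant 2 pays for the initial assignment and the last, failing test; each round
  adds its test and the increment to \<open>K\<close>. The body has to preserve the counter.\<close>

lemma achieves_for_loop:
  assumes bound: "\<And>s. nval E s b = n"
    and init: "I 0 (s\<lparr>nat_mem := (nat_mem s)(v := 0)\<rparr>)"
    and step: "\<And>i s. \<lbrakk>i < n; nat_mem s v = i; I i s\<rbrakk> \<Longrightarrow>
      achieves E P s K (\<lambda>s'. nat_mem s' v = i \<and> I (Suc i) (s'\<lparr>nat_mem := (nat_mem s')(v := Suc i)\<rparr>))"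
    and final: "\<And>s. \<lbrakk>nat_mem s v = n; I n s\<rbrakk> \<Longrightarrow> Q s"
  shows "achieves E (for_loop v b P) s (2 + n * (K + 2)) Q"
proof -
  let ?W = "While (NLess (NMem (NConst v)) b)
       (Seq P (NAssign (NConst v) (NPlus (NMem (NConst v)) (NConst 1))))"
  have loop: "achieves E ?W s (1 + d * (K + 2)) Q" if "nat_mem s v + d = n" "I (nat_mem s v) s" for s d
    using that
  proof (induction d arbitrary: s)
    case 0
    then have "big_step E ?W s 1 s" by (intro big_step.WhileFalse) (simp add: bound)
    then show ?case unfolding achieves_def using 0 final by auto
  next
    case (Suc d)
    obtain m s1 where 1: "big_step E P s m s1" "m \<le> K" "nat_mem s1 v = nat_mem s v"
      and I: "I (Suc (nat_mem s v)) (s1\<lparr>nat_mem := (nat_mem s1)(v := Suc (nat_mem s v))\<rparr>)"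
      using step[OF _ refl Suc.prems(2)] Suc.prems(1) unfolding achieves_def by auto
    define s2 where "s2 = s1\<lparr>nat_mem := (nat_mem s1)(v := Suc (nat_mem s v))\<rparr>"
    have 2: "big_step E (NAssign (NConst v) (NPlus (NMem (NConst v)) (NConst 1))) s1 1 s2"
      using big_step.NAssign[of E "NConst v" "NPlus (NMem (NConst v)) (NConst 1)" s1] 1(3)
      by (simp add: s2_def)
    have "achieves E ?W s2 (1 + d * (K + 2)) Q"
      by (rule Suc.IH) (use Suc.prems I in \<open>auto simp: s2_def\<close>)
    then obtain m' s' where 3: "big_step E ?W s2 m' s'" "m' \<le> 1 + d * (K + 2)" "Q s'"
      unfolding achieves_def by blast
    have "bval E s (NLess (NMem (NConst v)) b)" using Suc.prems by (simp add: bound)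
    from big_step.WhileTrue[OF this big_step.Seq[OF 1(1) 2] 3(1)]
    have "big_step E ?W s (Suc (m + 1 + m')) s'" .
    then show ?case unfolding achieves_def using 1(2) 3 by force
  qed
  have "achieves E (for_loop v b P) s (1 + (1 + n * (K + 2))) Q"
    unfolding for_loop_def
    by (intro achieves_Seq achieves_NAssign loop) (use init in simp_all)
  then show ?thesis by simp
qed


section \<open>The program\<close>

text \<open>Memory layout: natural registers 0, 1, 2 are loop counters, and register \<open>3 + i\<close> is 1 iff
  request \<open>i\<close> has been served. Real registers 0, 1, 2 hold the best trigger time so far, the
  candidate under consideration and an accumulator; real register \<open>3 + i\<close> holds \<open>early_load\<close>.\<close>

abbreviation (input) nreg :: "nat \<Rightarrow> nexp" where "nreg v \<equiv> NMem (NConst v)"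
abbreviation (input) rreg :: "nat \<Rightarrow> rexp" where "rreg v \<equiv> RMem (NConst v)"
abbreviation (input) slot :: "nat \<Rightarrow> nexp" where "slot v \<equiv> NPlus (NConst 3) (nreg v)"
abbreviation (input) unserved :: "nat \<Rightarrow> bexp" where "unserved v \<equiv> NLess (NMem (slot v)) (NConst 1)"
abbreviation (input) min_cost_exp :: "nat \<Rightarrow> rexp" where
  "min_cost_exp v \<equiv> CostAt (nreg v) (Deadline (nreg v))"
abbreviation (input) patience_exp :: "nat \<Rightarrow> rexp" where
  "patience_exp v \<equiv> LastTime (nreg v) (CostAt (nreg v) Now)"

definition sum_backlogs :: com where
  "sum_backlogs =
     Seq (RAssign (NConst 2) (RNat (NConst 0)))
       (for_loop 2 NumReleased
         (Cond (Conj (unserved 2) (Neg (RLess (rreg 1) (Deadline (nreg 2)))))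
           (RAssign (NConst 2) (RPlus (rreg 2) (RMinus (CostAt (nreg 2) (rreg 1)) (min_cost_exp 2))))
           Skip))"

definition find_trigger :: com where
  "find_trigger =
     Seq (RAssign (NConst 0) Now)
       (for_loop 0 NumReleased
         (Cond (unserved 0)
           (for_loop 1 (NPlus NumReleased (NConst 1))
             (Seq (RAssign (NConst 1) (LastTime (nreg 0)
                (RPlus (min_cost_exp 0) (RDivide (RTimes (RNat (nreg 1)) ServiceCost) (RNat NumReleased)))))
             (Seq sum_backlogs
               (Cond (Conj (RLess (rreg 0) (rreg 1))
                  (Neg (RLess (RTimes (RNat (NConst 2)) ServiceCost) (rreg 2))))
                 (RAssign (NConst 0) (rreg 1))
                 Skip))))
           Skip))"

definition early_loads :: com where
  "early_loads =
     for_loop 0 NumReleased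
       (Seq (RAssign (NConst 2) (RNat (NConst 0)))
       (Seq (for_loop 2 NumReleased
         (Cond (Conj (Conj (unserved 2) (RLess Now (Deadline (nreg 2))))
             (Neg (RLess (patience_exp 0) (patience_exp 2))))
           (RAssign (NConst 2) (RPlus (rreg 2) (RMinus (CostAt (nreg 2) Now) (min_cost_exp 2))))
           Skip))
         (RAssign (slot 0) (rreg 2))))"

definition serve_batch :: com where
  "serve_batch =
     for_loop 0 NumReleased
       (Cond (Conj (unserved 0)
           (Neg (Conj (RLess Now (Deadline (nreg 0))) (RLess ServiceCost (RMem (slot 0))))))
         (Seq (Serve (nreg 0)) (NAssign (slot 0) (NConst 1)))
         Skip)"

text \<open>The first search decides whether to serve now. The second one concerns the requests left
  over, and its result becomes the wake-up time, which is void if it equals the current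
  time.\<close>

definition program :: com where
  "program =
     Seq find_trigger
    (Seq (Cond (RLess Now (rreg 0)) Skip (Seq early_loads serve_batch))
    (Seq find_trigger (Wakeup (rreg 0))))"

text \<open>The step bounds are left unsimplified, in the shape in which the rules for
  \<open>achieves\<close> compose them.\<close>

definition sum_steps :: "nat \<Rightarrow> nat" where
  "sum_steps n = 1 + (2 + n * ((1 + 1) + 2))"

definition find_steps :: "nat \<Rightarrow> nat" where
  "find_steps n = 1 + (2 + n * ((1 + (2 + (n + 1) * ((1 + (sum_steps n + (1 + 1))) + 2))) + 2))"

definition load_steps :: "nat \<Rightarrow> nat" where
  "load_steps n = 2 + n * ((1 + ((2 + n * ((1 + 1) + 2)) + 1)) + 2)"

definition serve_steps :: "nat \<Rightarrow> nat" where
  "serve_steps n = 2 + n * ((1 + (1 + 1)) + 2)"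

definition program_steps :: "nat \<Rightarrow> nat" where
  "program_steps n =
     find_steps n + ((1 + (load_steps n + serve_steps n)) + (find_steps n + 1))"

lemma program_steps_mono: "m \<le> n \<Longrightarrow> program_steps m \<le> program_steps n"
  unfolding program_steps_def find_steps_def load_steps_def serve_steps_def sum_steps_def
  by (intro add_mono mult_le_mono order_refl)

definition marks :: "(nat \<Rightarrow> nat) \<Rightarrow> nat set \<Rightarrow> bool" where
  "marks M D \<longleftrightarrow> (\<forall>i. M (3 + i) = (if i \<in> D then 1 else 0))"

lemma marks_upd [simp]: "v < 3 \<Longrightarrow> marks (M(v := x)) D = marks M D"
  by (auto simp: marks_def)

lemma marks_insert: "marks M D \<Longrightarrow> marks (M(3 + i := Suc 0)) (insert i D)"
  by (auto simp: marks_def)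

lemma marksD: "marks M D \<Longrightarrow> M (3 + i) = (if i \<in> D then 1 else 0)"
  by (simp add: marks_def)

section \<open>Correctness and running time of the program\<close>

context jrp
begin

definition release_count :: "real \<Rightarrow> nat" where
  "release_count t = length (released_by \<sigma> t)"

lemma released_by_eq: "released_by \<sigma> t = take (release_count t) \<sigma>"
  unfolding release_count_def released_by_def by (rule takeWhile_eq_take)

lemma arrival_mono: "\<lbrakk>i \<le> k; k < length \<sigma>\<rbrakk> \<Longrightarrow> arrival (\<sigma> ! i) \<le> arrival (\<sigma> ! k)"
  using sequence sorted_nth_mono[of "map arrival \<sigma>" i k] by (auto simp: request_sequence_def)

lemma release_count_le: "release_count t \<le> length \<sigma>"
  unfolding release_count_def released_by_def by (rule length_takeWhile_le)

text \<open>Arrivals are sorted, so the released requests are a prefix and keep their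
  positions.\<close>

lemma less_release_count_iff: "i < release_count t \<longleftrightarrow> i < length \<sigma> \<and> arrival (\<sigma> ! i) \<le> t"
proof
  assume i: "i < release_count t"
  then have "takeWhile (\<lambda>p. arrival p \<le> t) \<sigma> ! i \<in> set (takeWhile (\<lambda>p. arrival p \<le> t) \<sigma>)"
    by (intro nth_mem) (simp add: release_count_def released_by_def)
  then have "arrival (takeWhile (\<lambda>p. arrival p \<le> t) \<sigma> ! i) \<le> t" by (auto dest: set_takeWhileD)
  then show "i < length \<sigma> \<and> arrival (\<sigma> ! i) \<le> t"
    using i release_count_le[of t] takeWhile_nth[of i "\<lambda>p. arrival p \<le> t" \<sigma>]
    by (simp add: release_count_def released_by_def)
next
  assume i: "i < length \<sigma> \<and> arrival (\<sigma> ! i) \<le> t"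
  show "i < release_count t"
  proof (rule ccontr)
    assume n: "\<not> ?thesis"
    then have "release_count t < length \<sigma>" using i by simp
    then have "\<not> arrival (\<sigma> ! release_count t) \<le> t"
      using nth_length_takeWhile[of "\<lambda>p. arrival p \<le> t" \<sigma>] by (simp add: release_count_def released_by_def)
    then show False using arrival_mono[of "release_count t" i] n i by simp
  qed
qed

lemma pending_eq: "pending D t = {..<release_count t} - D"
  by (auto simp: pending_def less_release_count_iff)

lemma query_env_at [simp]:
  "i < release_count t \<Longrightarrow> query (env_at c \<sigma> t) i f = f (\<sigma> ! i)"
  using release_count_le by (simp add: query_def env_at_def released_by_eq)

lemma env_at_simps [simp]:
  "service_cost (env_at c \<sigma> t) = c" "now (env_at c \<sigma> t) = t"
  "length (released (env_at c \<sigma> t)) = release_count t"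
  by (simp_all add: env_at_def release_count_def)

lemma arrival_le_deadline: "i < release_count t \<Longrightarrow> arrival (\<sigma> ! i) \<le> deadline (\<sigma> ! i)"
  by (simp add: less_release_count_iff valid valid_requestD)

lemma sum_backlogs_correct:
  assumes D: "marks (nat_mem s) D"
  shows "achieves (env_at c \<sigma> t) sum_backlogs s (sum_steps (release_count t))
    (\<lambda>s'. s' = s\<lparr>nat_mem := (nat_mem s)(2 := release_count t),
       real_mem := (real_mem s)(2 := total_backlog (pending D t) (real_mem s 1))\<rparr>)"
  unfolding sum_backlogs_def sum_steps_def
  apply (rule achieves_Seq, rule achieves_RAssign)
  apply (rule achieves_for_loop[where I = "\<lambda>i s'. s' = s\<lparr>nat_mem := (nat_mem s)(2 := i),
       real_mem := (real_mem s)(2 := total_backlog ({..<i} - D) (real_mem s 1))\<rparr>"])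
     apply simp
    apply (simp add: total_backlog_def)
   subgoal for i s'
     apply (rule achieves_Cond)
      apply (rule achieves_RAssign)
     \<comment> \<open>Costs are queried only from the deadline on, hence not before the arrival,
       where the oracle would return 0.\<close>
     using D arrival_le_deadline[of i t]
      apply (auto simp: marksD lessThan_Suc insert_Diff_if total_backlog_def
        backlog_def[of "\<sigma> ! i"] min_cost_def[of "\<sigma> ! i"] intro!: achieves_Skip state.equality)
     done
  apply (simp add: pending_eq)
  done

lemma find_trigger_correct:
  assumes D: "marks (nat_mem s) D"
  shows "achieves (env_at c \<sigma> t) find_trigger s (find_steps (release_count t))
    (\<lambda>s'. marks (nat_mem s') D \<and> served_now s' = served_now s \<and> wakeup s' = wakeup s \<and>
       is_trigger (release_count t) (pending D t) t (real_mem s' 0))"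
proof -
  let ?r = "release_count t" and ?B = "total_backlog (pending D t)"
  \<comment> \<open>The candidates met before level \<open>j\<close> of request \<open>i\<close>, in
    the lexicographic order of the nested loops.\<close>
  define C where "C i j = {X. ?B X \<le> 2 * c \<and>
    (\<exists>k j'. k \<notin> D \<and> (k < i \<and> j' \<le> ?r \<or> k = i \<and> j' < j) \<and> X = level_time ?r k j')}" for i j :: nat
  define is_max where "is_max T A \<longleftrightarrow> T \<in> insert t A \<and> (\<forall>X \<in> insert t A. X \<le> T)" for T :: real and A
  define I where "I i j s' \<longleftrightarrow> marks (nat_mem s') D \<and> served_now s' = served_now s \<and> wakeup s' = wakeup s \<and>
    is_max (real_mem s' 0) (C i j)" for i j :: nat and s' :: state
  have C0: "C 0 0 = {}" by (auto simp: C_def)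
  have C_step: "C i (Suc j) = (if ?B (level_time ?r i j) \<le> 2 * c then insert (level_time ?r i j) (C i j) else C i j)"
    if "i \<notin> D" for i j
    using that by (auto simp: C_def less_Suc_eq)
  \<comment> \<open>Levels 0 to \<open>?r\<close> make \<open>Suc ?r\<close> rounds of the inner
    loop.\<close>
  have C_next: "C i (Suc ?r) = C (Suc i) 0" for i
    unfolding C_def less_Suc_eq[of _ i] by (auto simp: less_Suc_eq_le)
  have C_skip: "C (Suc i) 0 = C i 0" if "i \<in> D" for i
    using that by (auto simp: C_def less_Suc_eq)
  have C_final: "C ?r 0 = candidates ?r (pending D t)"
    by (auto simp: C_def candidates_def pending_eq)
  have is_max_insert: "is_max (if T < X then X else T) (insert X A)" if "is_max T A" for T X A
    using that unfolding is_max_def by force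
  show ?thesis
    unfolding find_trigger_def find_steps_def
    apply (rule achieves_Seq, rule achieves_RAssign)
    apply (rule achieves_for_loop[where I = "\<lambda>i. I i 0"])
       apply simp
      apply (use D in \<open>simp add: I_def C0 is_max_def\<close>)
     subgoal for i s1
       apply (rule achieves_Cond)
        apply (rule achieves_for_loop[where I = "\<lambda>j s'. nat_mem s' 0 = i \<and> I i j s'"])
           apply simp
          apply (simp add: I_def)
         subgoal for j s2
           apply (rule achieves_Seq, rule achieves_RAssign)
           apply (rule achieves_Seq)
           apply (rule achieves_weaken)
            apply (rule sum_backlogs_correct[where D = D])
            apply (simp add: I_def)
           apply (simp only:)
           apply (rule achieves_Cond)
            apply (rule achieves_RAssign)
           using D is_max_insert[of "real_mem s2 0" "C i j" "level_time ?r i j"] arrival_le_deadline[of i t]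
            apply (auto simp: I_def C_step marksD level_time_def min_cost_def split: if_splits
              intro!: achieves_Skip)
           done
        apply (simp add: C_next I_def)
       apply (rule achieves_Skip)
        apply (auto simp: I_def C_skip marksD split: if_splits)
       done
    apply (simp add: I_def C_final is_max_def is_trigger_def)
    done
qed

lemma early_loads_correct:
  assumes D: "marks (nat_mem s) D"
  shows "achieves (env_at c \<sigma> t) early_loads s (load_steps (release_count t))
    (\<lambda>s'. marks (nat_mem s') D \<and> served_now s' = served_now s \<and> wakeup s' = wakeup s \<and>
       (\<forall>k<release_count t. real_mem s' (3 + k) = early_load (pending D t) t k))"
proof -
  let ?r = "release_count t"
  define A where "A i j = {k \<in> {..<j} - D. t < deadline (\<sigma> ! k) \<and> patience k t \<le> patience i t}" for i j :: nat
  have A_step: "A i (Suc j) = (if j \<notin> D \<and> t < deadline (\<sigma> ! j) \<and> patience j t \<le> patience i t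
    then insert j (A i j) else A i j)" for i j
    by (auto simp: A_def less_Suc_eq)
  have A_fresh: "j \<notin> A i j" "finite (A i j)" for i j by (auto simp: A_def)
  have A_final: "(\<Sum>k\<in>A i ?r. holding k t) = early_load (pending D t) t i" for i
    by (simp add: early_load_def pending_eq A_def)
  define I where "I i s' \<longleftrightarrow> marks (nat_mem s') D \<and> served_now s' = served_now s \<and> wakeup s' = wakeup s \<and>
    (\<forall>k<i. real_mem s' (3 + k) = early_load (pending D t) t k)" for i :: nat and s' :: state
  show ?thesis
    unfolding early_loads_def load_steps_def
    apply (rule achieves_for_loop[where I = I])
       apply simp
      apply (use D in \<open>simp add: I_def\<close>)
     subgoal for i s1
       apply (rule achieves_Seq, rule achieves_RAssign)
       apply (rule achieves_Seq)
       apply (rule achieves_for_loop[where I = "\<lambda>j s'. nat_mem s' 0 = i \<and> I i s' \<and>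
         real_mem s' 2 = (\<Sum>k\<in>A i j. holding k t)"])
          apply simp
         apply (simp add: A_def I_def)
        subgoal for j s2
          apply (rule achieves_Cond)
           apply (rule achieves_RAssign)
          using less_release_count_iff[of i t] less_release_count_iff[of j t] arrival_le_deadline[of j t]
           apply (auto simp: I_def A_step A_fresh marksD holding_def patience_def min_cost_def
             split: if_splits intro!: achieves_Skip)
          done
       apply (rule achieves_RAssign)
       apply (auto simp: I_def A_final less_Suc_eq)
       done
    apply (simp add: I_def)
    done
qed

lemma serve_batch_correct:
  assumes D: "marks (nat_mem s) D" and none: "served_now s = {}"
    and loads: "\<forall>k<release_count t. real_mem s (3 + k) = early_load (pending D t) t k"
  shows "achieves (env_at c \<sigma> t) serve_batch s (serve_steps (release_count t))
    (\<lambda>s'. marks (nat_mem s') (D \<union> served_now s') \<and> served_now s' = batch (pending D t) t)"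
proof -
  let ?r = "release_count t" and ?B = "batch (pending D t) t"
  have B_iff: "i \<in> ?B \<longleftrightarrow> i \<notin> D \<and> (t < deadline (\<sigma> ! i) \<longrightarrow> early_load (pending D t) t i \<le> c)"
    if "i < ?r" for i
    using that by (auto simp: batch_def pending_eq)
  define S where "S i = {k \<in> ?B. k < i}" for i
  have S_step: "S (Suc i) = (if i \<in> ?B then insert i (S i) else S i)" for i
    by (auto simp: S_def less_Suc_eq)
  \<comment> \<open>The loop has not marked request \<open>i\<close> yet, so its register still
    tells whether it was served in an earlier run.\<close>
  have S_fresh: "i \<notin> S i" for i by (simp add: S_def)
  have S_final: "S ?r = ?B" by (auto simp: S_def batch_def pending_eq)
  show ?thesis
    unfolding serve_batch_def serve_steps_def
    apply (rule achieves_for_loop[where I = "\<lambda>i s'. marks (nat_mem s') (D \<union> S i) \<and> served_now s' = S i \<and>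
      real_mem s' = real_mem s"])
       apply simp
      apply (use D none in \<open>simp add: S_def\<close>)
     subgoal for i s1
       apply (rule achieves_Cond)
        apply (rule achieves_Seq, rule achieves_Serve, rule achieves_NAssign)
       using loads marks_insert[of "nat_mem s1" "D \<union> S i" i] less_release_count_iff[of i t]
        apply (auto simp: B_iff S_step S_fresh marksD split: if_splits intro!: achieves_Skip)
       done
    apply (simp add: S_final)
    done
qed

lemma program_correct:
  assumes D: "marks (nat_mem s) D" and none: "served_now s = {}"
  shows "achieves (env_at c \<sigma> t) program s (program_steps (release_count t))
    (\<lambda>s'. \<exists>T1 T2. is_trigger (release_count t) (pending D t) t T1 \<and>
       served_now s' = (if t < T1 then {} else batch (pending D t) t) \<and>
       marks (nat_mem s') (D \<union> served_now s') \<and>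
       is_trigger (release_count t) (pending (D \<union> served_now s') t) t T2 \<and> wakeup s' = Some T2)"
    (is "achieves ?E _ _ _ ?Q")
proof -
  have last: "achieves ?E (Seq find_trigger (Wakeup (rreg 0))) s2 (find_steps (release_count t) + 1) ?Q"
    if "marks (nat_mem s2) (D \<union> served_now s2)" "is_trigger (release_count t) (pending D t) t T1"
      "served_now s2 = (if t < T1 then {} else batch (pending D t) t)" for s2 T1
    apply (rule achieves_Seq)
    apply (rule achieves_weaken[OF find_trigger_correct[OF that(1)]])
    apply (rule achieves_Wakeup)
    apply (rule exI[of _ T1])
    using that apply auto
    done
  show ?thesis
    unfolding program_def program_steps_def
    apply (rule achieves_Seq)
    apply (rule achieves_weaken[OF find_trigger_correct[OF D]])
    apply (rule achieves_Seq)
    apply (rule achieves_Cond)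
     apply (rule achieves_Skip)
      apply (rule last)
        apply (auto simp: none)[3]
     apply (simp add: load_steps_def)
    apply (rule achieves_Seq)
    apply (elim conjE)
    apply (rule achieves_weaken[OF early_loads_correct])
     apply assumption
    apply (elim conjE)
    apply (rule achieves_weaken[OF serve_batch_correct])
       apply (auto simp: none)[3]
    apply (rule last)
      apply (auto simp: none)
    done
qed

text \<open>The potential \<open>2 * unreleased + pending\<close> decreases in every run: a run at an arrival time
  turns unreleased requests into pending ones, and any other run serves at least one request.\<close>

lemma execution_exists:
  assumes "r = release_count l" "l' \<le> l" "D \<subseteq> {..<r}"
    and "\<forall>i. M (3 + i) = (if i \<in> D then 1 else 0)"
    and "case w of None \<Rightarrow> pending D l = {} | Some T \<Rightarrow> l < T \<and> is_trigger r (pending D l) l T"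
  shows "\<exists>S m. execution_from program c \<sigma> r w M R S m \<and> threshold_schedule l' D S \<and>
    m \<le> (2 * (length \<sigma> - r) + card (pending D l)) * program_steps (length \<sigma>)"
  using assms
proof (induction "2 * (length \<sigma> - r) + card (pending D l)" arbitrary: r l l' D M w R rule: less_induct)
  case less
  let ?n = "length \<sigma>"
  note r = less.prems(1) and l' = less.prems(2) and D = less.prems(3) and M = less.prems(4)
    and w = less.prems(5)
  have rn: "r \<le> ?n" using r release_count_le by simp
  have next_arrival: "l < arrival (\<sigma> ! i)" if "i < ?n" "r \<le> i" for i
    using that less_release_count_iff[of i l] r by auto
  show ?case
  proof (cases "next_event \<sigma> r w")
    case None
    then have "w = None" "\<not> r < ?n" by (cases w; simp split: if_splits)+
    then have "?n = r" "pending D l = {}" using w rn by auto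
    then have "{..<?n} \<subseteq> D" using r by (auto simp: pending_eq)
    then show ?thesis using execution_from.Done[OF None] by fastforce
  next
    case (Some t)
    let ?r = "release_count t" and ?U = "pending D t"
    have lt: "l < t" using Some w next_arrival[of r] by (cases w) (auto split: if_splits)
    have t_arrival: "t \<le> arrival (\<sigma> ! i)" if "i < ?n" "r \<le> i" for i
      using Some that arrival_mono[of r i] by (cases w) (auto split: if_splits)
    have rr: "r \<le> ?r" using lt less_release_count_iff[of "r - 1" l] less_release_count_iff[of "r - 1" t] r
      by (cases r) auto
    have UV: "?U = pending D l \<union> {r..<?r}" using rr D r by (auto simp: pending_eq)
    \<comment> \<open>The next event is never later than the next arrival, so requests released at
      \<open>t\<close> cannot be overdue.\<close>
    have new: "backlog (\<sigma> ! i) t = 0" if "i \<in> {r..<?r}" for i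
    proof -
      have "i < ?n" using that release_count_le[of t] by simp
      then have "t \<le> deadline (\<sigma> ! i)"
        using t_arrival[of i] valid_requestD(1)[OF valid, of i] that by simp
      then show ?thesis by (rule backlog_eq_0)
    qed
    \<comment> \<open>Only requests pending since \<open>l\<close> contribute. Their wake-up time
      \<open>T > l\<close> is a candidate with backlog at most \<open>2 * c\<close>, and
      \<open>t\<close> is not later.\<close>
    have small: "total_backlog ?U t \<le> 2 * c"
    proof -
      have "total_backlog ?U t = total_backlog (pending D l) t"
        unfolding total_backlog_def UV using new
        by (intro sum.mono_neutral_right) (auto simp: pending_eq)
      also have "\<dots> \<le> 2 * c"
      proof (cases w)
        case None
        then show ?thesis using w c_pos by (simp add: total_backlog_def)
      next
        case (Some T)
        then have "t \<le> T" using \<open>next_event \<sigma> r w = Some t\<close> by (auto split: if_splits)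
        then have "total_backlog (pending D l) t \<le> total_backlog (pending D l) T"
          by (intro total_backlog_mono valid_pending)
        also have "\<dots> \<le> 2 * c" using w Some by (auto simp: is_trigger_def candidates_def)
        finally show ?thesis .
      qed
      finally show ?thesis .
    qed
    let ?s = "\<lparr>nat_mem = M, real_mem = R, served_now = {}, wakeup = None\<rparr>"
    have "marks (nat_mem ?s) D" using M by (simp add: marks_def)
    then obtain m s T1 T2 where run: "big_step (env_at c \<sigma> t) program ?s m s"
      and m: "m \<le> program_steps ?r" and T1: "is_trigger ?r ?U t T1"
      and J: "served_now s = (if t < T1 then {} else batch ?U t)"
      and marks: "marks (nat_mem s) (D \<union> served_now s)"
      and T2: "is_trigger ?r (pending (D \<union> served_now s) t) t T2" and wake: "wakeup s = Some T2"
      using program_correct[of ?s D t] unfolding achieves_def by auto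
    let ?J = "served_now s"
    let ?U' = "pending (D \<union> ?J) t"
    have JU: "?J \<subseteq> ?U" using J batch_subset by (auto split: if_splits)
    have U': "?U' = ?U - ?J" by (auto simp: pending_eq)
    have DJ: "D \<union> ?J \<subseteq> {..<?r}" using D rr JU by (auto simp: pending_eq)
    have t_trig: "c \<le> total_backlog ?U t'" if "\<not> t < T1" "t < t'" "?U \<noteq> {}" for t'
    proof -
      have "T1 = t" using T1 that by (auto simp: is_trigger_def)
      then show ?thesis using trigger_backlog[of ?U ?r t t'] T1 that release_count_le[of t]
        by (auto simp: pending_eq)
    qed
    \<comment> \<open>Without a release the run is due to a wake-up, which is a candidate and thus
      stems from a pending request.\<close>
    have "?U \<noteq> {}"
    proof (cases "r < ?r")
      case True
      then show ?thesis using UV by auto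
    next
      case False
      then have "w \<noteq> None" "w \<noteq> None \<longrightarrow> pending D l \<noteq> {}"
        using Some w r rr less_release_count_iff[of r t]
        by (auto simp: is_trigger_def candidates_def split: if_splits option.splits)
      then show ?thesis using UV by auto
    qed
    have J_nonempty: "?J \<noteq> {}" if serving: "\<not> t < T1"
    proof -
      obtain i where "i \<in> ?U" "deadline (\<sigma> ! i) \<le> t"
        using trigger_imp_due[of ?U t] t_trig[OF serving] \<open>?U \<noteq> {}\<close> by auto
      then show ?thesis using batch_due[of i ?U t] J serving by auto
    qed
    \<comment> \<open>Without a release the run takes place at the wake-up time \<open>T\<close>.
      Pending requests and candidates are the same as at \<open>l\<close>, so no candidate is later
      than \<open>T\<close>.\<close>
    have serve: "\<not> t < T1" if "?r = r"
    proof -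
      have "\<not> (r < ?n \<and> t = arrival (\<sigma> ! r))" using that less_release_count_iff[of r t] by auto
      then obtain T where T: "w = Some T" "t = T"
        using Some by (cases w) (auto split: if_splits simp: min_def)
      have "is_trigger r ?U l T" using w T UV that by simp
      then have "is_trigger r ?U t t" using lt T by (auto simp: is_trigger_def)
      then show ?thesis using T1 that by (auto simp: is_trigger_def)
    qed
    have card_U: "card ?U = card (pending D l) + (?r - r)"
      unfolding UV using r by (subst card_Un_disjoint) (auto simp: pending_eq)
    have card_U': "card ?U' = card ?U - card ?J" "card ?J \<le> card ?U"
      unfolding U' using JU finite_subset[OF JU] by (auto intro: card_Diff_subset card_mono)
    have decrease: "2 * (?n - ?r) + card ?U' < 2 * (?n - r) + card (pending D l)"
    proof (cases "?r = r")
      case True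
      then have "0 < card ?J" using J_nonempty serve finite_subset[OF JU] by (auto simp: card_gt_0_iff)
      then show ?thesis using card_U card_U' True by simp
    next
      case False
      then show ?thesis using card_U card_U' rr release_count_le[of t] by simp
    qed
    \<comment> \<open>A void wake-up must not leave requests pending. Otherwise one of them would be
      due at \<open>t\<close>; but a service takes all due requests, and without a service both
      searches agree, so that \<open>T2 = T1 > t\<close>.\<close>
    have wake': "case wakeup_after t s of None \<Rightarrow> ?U' = {} | Some T \<Rightarrow> t < T \<and> is_trigger ?r ?U' t T"
    proof (cases "t < T2")
      case False
      then have t2: "T2 = t" using T2 by (auto simp: is_trigger_def)
      have "?U' = {}"
      proof (rule ccontr)
        assume ne: "?U' \<noteq> {}"
        have "\<And>t'. t < t' \<Longrightarrow> c \<le> total_backlog ?U' t'"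
          using trigger_backlog[of ?U' ?r t] ne T2 t2 release_count_le[of t] by (auto simp: pending_eq)
        then obtain i where i: "i \<in> ?U'" "deadline (\<sigma> ! i) \<le> t"
          using trigger_imp_due[of ?U' t] by auto
        show False
        proof (cases "t < T1")
          case True
          then have "T1 = T2" using T1 T2 J t2 by (auto simp: is_trigger_def)
          then show False using True t2 by simp
        next
          case False
          have "i \<in> ?U" "i \<notin> ?J" using i(1) unfolding U' by auto
          then show False using False i(2) J batch_due[of i ?U t] by simp
        qed
      qed
      then show ?thesis using False wake by (simp add: wakeup_after_def)
    qed (use T2 wake in \<open>simp add: wakeup_after_def\<close>)
    \<comment> \<open>The time of the last run always advances to \<open>t\<close>, the time of the
      last service only if this run serves.\<close>
    have "\<exists>S m. execution_from program c \<sigma> ?r (wakeup_after t s) (nat_mem s) (real_mem s) S m \<and>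
      threshold_schedule (if t < T1 then l' else t) (D \<union> ?J) S \<and>
      m \<le> (2 * (?n - ?r) + card ?U') * program_steps ?n"
      using less.hyps[OF decrease refl _ DJ _ wake'] l' lt marksD[OF marks] by auto
    then obtain S k where S: "execution_from program c \<sigma> ?r (wakeup_after t s) (nat_mem s) (real_mem s) S k"
      "threshold_schedule (if t < T1 then l' else t) (D \<union> ?J) S"
      "k \<le> (2 * (?n - ?r) + card ?U') * program_steps ?n" by blast
    have "execution_from program c \<sigma> r w M R (service_of t s @ S) (m + k)"
      using execution_from.Run[OF Some run, of S k] S(1) by (simp add: release_count_def)
    moreover have "threshold_schedule l' D (service_of t s @ S)"
    proof (cases "t < T1")
      case True
      then show ?thesis using S(2) J by (simp add: service_of_def)
    next
      case False
      then show ?thesis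
        using S(2) J J_nonempty l' lt small t_trig \<open>?U \<noteq> {}\<close> by (simp add: service_of_def)
    qed
    moreover have "m + k \<le> (2 * (?n - r) + card (pending D l)) * program_steps ?n"
    proof -
      have "m + k \<le> program_steps ?n + (2 * (?n - ?r) + card ?U') * program_steps ?n"
        using m program_steps_mono[OF release_count_le[of t]] S(3) by linarith
      also have "\<dots> = Suc (2 * (?n - ?r) + card ?U') * program_steps ?n" by simp
      also have "\<dots> \<le> (2 * (?n - r) + card (pending D l)) * program_steps ?n"
        using decrease by (intro mult_le_mono1) simp
      finally show ?thesis .
    qed
    ultimately show ?thesis by blast
  qed
qed

lemma program_execution:
  obtains S m where "execution program c \<sigma> S m" "m \<le> 2 * length \<sigma> * program_steps (length \<sigma>)"
    "feasible \<sigma> S" "schedule_cost c \<sigma> S \<le> 4 * OPT c \<sigma>"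
proof -
  \<comment> \<open>A time before the first arrival acts as the previous service; 0 is a default for
    the empty sequence.\<close>
  define l where "l = (if \<sigma> = [] then 0 else arrival (\<sigma> ! 0) - 1)"
  have l: "l < arrival (\<sigma> ! i)" if "i < length \<sigma>" for i
    using arrival_mono[of 0 i] that by (auto simp: l_def)
  have r: "0 = release_count l"
    using less_release_count_iff[of 0 l] l[of 0] by auto
  then have p: "pending {} l = {}" by (simp add: pending_eq)
  obtain S m where S: "execution program c \<sigma> S m" "threshold_schedule l {} S"
    "m \<le> 2 * length \<sigma> * program_steps (length \<sigma>)"
    \<comment> \<open>With nothing released, the potential is
      \<open>2 * length \<sigma>\<close>.\<close>
    using execution_exists[OF r order_refl, of "{}" "\<lambda>_. 0" None "\<lambda>_. 0"] p
    unfolding execution_def by auto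
  then show thesis using that threshold_schedule_competitive[OF S(2) l] by blast
qed

end

text \<open>Evaluation commutes with sums and products, so the step bound with the indeterminate in
  place of \<open>n\<close> is the polynomial.\<close>

lemma program_steps_poly: "\<exists>q. \<forall>n. 2 * n * program_steps n = poly q n"
proof -
  let ?n = "[:0, 1:] :: nat poly"
  let ?sum = "1 + (2 + ?n * ((1 + 1) + 2))"
  let ?find = "1 + (2 + ?n * ((1 + (2 + (?n + 1) * ((1 + (?sum + (1 + 1))) + 2))) + 2))"
  let ?load = "2 + ?n * ((1 + ((2 + ?n * ((1 + 1) + 2)) + 1)) + 2)"
  let ?serve = "2 + ?n * ((1 + (1 + 1)) + 2)"
  let ?q = "2 * ?n * (?find + ((1 + (?load + ?serve)) + (?find + 1)))"
  have "2 * n * program_steps n = poly ?q n" for n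
    unfolding program_steps_def find_steps_def load_steps_def serve_steps_def sum_steps_def
    by (simp only: poly_add poly_mult poly_1 poly_numeral poly_pCons poly_0 mult_1_right add_0_left mult_zero_right add_0_right)
  then show ?thesis by blast
qed

theorem theorem1:
  shows "\<exists>P :: com. polynomial_time P \<and> competitive 4 P"
proof (intro exI conjI)
  obtain q where q: "\<And>n. 2 * n * program_steps n = poly q n" using program_steps_poly by blast
  show "polynomial_time program"
    unfolding polynomial_time_def
  proof (intro exI[of _ q] allI impI)
    fix c :: real and \<sigma> assume "0 < c" "request_sequence \<sigma>"
    then interpret jrp c \<sigma> by unfold_locales
    obtain S n where "execution program c \<sigma> S n" "n \<le> 2 * length \<sigma> * program_steps (length \<sigma>)"
      using program_execution by blast
    then show "\<exists>S n. execution program c \<sigma> S n \<and> n \<le> poly q (length \<sigma>)"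
      unfolding q by blast
  qed
  show "competitive 4 program"
    unfolding competitive_def
  proof (intro allI impI)
    fix c :: real and \<sigma> assume "0 < c" "request_sequence \<sigma>"
    then interpret jrp c \<sigma> by unfold_locales
    show "\<exists>S n. execution program c \<sigma> S n \<and> feasible \<sigma> S \<and> schedule_cost c \<sigma> S \<le> 4 * OPT c \<sigma>"
      using program_execution by metis
  qed
qed

end
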